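(* Let $a<b$, $c<d$, $\Delta=[a,b]\times[c,d]\subset\mathbb{R}^2$, and let $f:\Delta\to\mathbb{R}$ be an absolutely continuous function on $\Delta$. If $\frac{\partial^2 f}{\partial t\partial\lambda}\in L(\Delta)$, then for any fixed $r_1,r_2\in[0,1]$ the following equality holds: $$\frac{f(a,c)+r_2f(a,d)+r_1f(b,c)+r_1r_2f(b,d)}{(r_1+1)(r_2+1)}+\frac{1}{(b-a)(d-c)}\int_a^b\int_c^d f(x,y)\,dx\,dy$$ $$-\left(\frac{r_1}{r_1+1}\right)\frac{1}{d-c}\int_c^d f(b,y)\,dy-\left(\frac{1}{r_1+1}\right)\frac{1}{d-c}\int_c^d f(a,y)\,dy$$ $$-\left(\frac{r_2}{r_2+1}\right)\frac{1}{b-a}\int_a^b f(x,d)\,dx-\left(\frac{1}{r_2+1}\right)\frac{1}{b-a}\int_a^b f(x,c)\,dx$$ $$=\frac{(b-a)(d-c)}{(r_1+1)(r_2+1)}\int_0^1\int_0^1\big((r_1+1)t-1\big)\big((r_2+1)\lambda-1\big)\frac{\partial^2 f}{\partial t\partial\lambda}\big(tb+(1-t)a,\ \lambda d+(1-\lambda)c\big)\,dt\,d\lambda.$$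
   Context: $\frac{\partial^2 f}{\partial t\partial\lambda}$ denotes the second-order mixed partial derivative of $f$ with respect to its first and second variables, evaluated at the indicated point of $\Delta$; $L(\Delta)$ is the space of Lebesgue integrable functions on $\Delta$. In $\int_a^b\int_c^d f(x,y)\,dx\,dy$ the variable $x$ ranges over $[a,b]$ and $y$ over $[c,d]$. *)

theory Defs
  imports "HOL-Analysis.Analysis"
begin

text \<open>
  Absolute continuity on an interval of the real line.  The families \<open>D\<close> that are a division of
  their own union are exactly the finite families of pairwise non-overlapping nonempty
  compact intervals.
\<close>

definition abs_continuous_on :: "real set \<Rightarrow> (real \<Rightarrow> real) \<Rightarrow> bool" where
  "abs_continuous_on S g \<longleftrightarrow>
    (\<forall>\<epsilon>>0. \<exists>\<delta>>0. \<forall>D. D division_of \<Union>D \<and> \<Union>D \<subseteq> S \<and> (\<Sum>K\<in>D. measure lborel K) < \<delta> \<longrightarrow>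
      (\<Sum>K\<in>D. \<bar>g (interval_upperbound K) - g (interval_lowerbound K)\<bar>) < \<epsilon>)"

definition rect_increment :: "(real \<times> real \<Rightarrow> real) \<Rightarrow> (real \<times> real) set \<Rightarrow> real" where
  "rect_increment f K =
    (let (x1, y1) = interval_lowerbound K; (x2, y2) = interval_upperbound K
     in f (x2, y2) - f (x1, y2) - f (x2, y1) + f (x1, y1))"

text \<open>
  Absolute continuity of a function of two variables on a rectangle, in the sense of
  Caratheodory.  The condition on rectangle increments does not see summands depending on one
  variable only, so absolute continuity along two adjacent sides of the rectangle is
  required in addition.
\<close>

definition abs_continuous_on_rect ::
    "real \<Rightarrow> real \<Rightarrow> real \<Rightarrow> real \<Rightarrow> (real \<times> real \<Rightarrow> real) \<Rightarrow> bool" where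
  "abs_continuous_on_rect a b c d f \<longleftrightarrow>
    (\<forall>\<epsilon>>0. \<exists>\<delta>>0. \<forall>D. D division_of \<Union>D \<and> \<Union>D \<subseteq> {a..b} \<times> {c..d} \<and> (\<Sum>K\<in>D. measure lborel K) < \<delta> \<longrightarrow>
      (\<Sum>K\<in>D. \<bar>rect_increment f K\<bar>) < \<epsilon>) \<and>
    abs_continuous_on {a..b} (\<lambda>x. f (x, c)) \<and>
    abs_continuous_on {c..d} (\<lambda>y. f (a, y))"

text \<open>
  Derivatives are taken within the sides of the rectangle \<open>S \<times> T\<close>, so that only the values of
  \<open>f\<close> on the rectangle matter (one-sided derivatives on its boundary).  The mixed derivative
  differentiates in the second variable first.
\<close>

definition partial2 :: "real set \<Rightarrow> (real \<times> real \<Rightarrow> real) \<Rightarrow> real \<times> real \<Rightarrow> real" where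
  "partial2 T f p = vector_derivative (\<lambda>u. f (fst p, u)) (at (snd p) within T)"

definition mixed_partial ::
    "real set \<Rightarrow> real set \<Rightarrow> (real \<times> real \<Rightarrow> real) \<Rightarrow> real \<times> real \<Rightarrow> real" where
  "mixed_partial S T f p =
    vector_derivative (\<lambda>s. partial2 T f (s, snd p)) (at (fst p) within S)"

text \<open>
  \<^const>\<open>vector_derivative\<close> is total, so existence has to be stated separately: the inner
  derivative must exist at all points of the horizontal section near \<open>p\<close>.
\<close>

definition mixed_partial_exists ::
    "real set \<Rightarrow> real set \<Rightarrow> (real \<times> real \<Rightarrow> real) \<Rightarrow> real \<times> real \<Rightarrow> bool" where
  "mixed_partial_exists S T f p \<longleftrightarrow>
    (\<forall>\<^sub>F s in nhds (fst p). s \<in> S \<longrightarrow> (\<lambda>u. f (s, u)) differentiable (at (snd p) within T)) \<and>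
    (\<lambda>s. partial2 T f (s, snd p)) differentiable (at (fst p) within S)"

end

theory Submission
  imports Defs
begin

text \<open>
  Absolute continuity makes the rectangle increments of \<open>f\<close> the integrals of a density \<open>h\<close>: the
  difference quotients \<open>h\<^sub>n\<close> of the increments over dyadic grids form a uniformly integrable
  martingale, and the strict convexity of \<open>u \<mapsto> sqrt (1 + u\<^sup>2)\<close> turns the boundedness of the energies
  \<open>\<integral> sqrt (1 + h\<^sub>n\<^sup>2)\<close> into convergence in \<open>L\<^sup>1\<close>.  The mixed partial derivative agrees with \<open>h\<close> almost
  everywhere: for almost every \<open>y\<close> and all rational \<open>q\<close>, the derivative of \<open>f (q, \<cdot>) - f (a, \<cdot>)\<close> at
  \<open>y\<close> is \<open>\<integral>\<^sub>a\<^sup>q h (s, y) ds\<close>, and where both \<open>\<partial>\<^sub>2 f (\<cdot>, y)\<close> and this integral are differentiable in the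
  first variable, their derivatives are determined by the rational points.  With \<open>h\<close> in place of the
  mixed partial derivative, the identity is integration by parts in each variable.
\<close>


section \<open>Mean convergence and a convexity estimate\<close>

text \<open>A quadratic energy would need quotients bounded in L^2, but absolute continuity bounds
  them only in L^1. The function \<open>sqrt (1 + u^2)\<close> is strictly convex and yet grows
  linearly, so its energies stay bounded along with the L^1 norms. The price is that its convexity
  degenerates at infinity: large values have to be cut off, and uniform integrability makes their
  contribution small. Null sets shape the comparison with the mixed derivative. The exceptional set
  of \<open>y\<close> belonging to \<open>f (q, y) - f (a, y)\<close> depends on \<open>q\<close>,
  so only countably many \<open>q\<close> can be treated at once. The outcome holds for almost every
  \<open>y\<close> and then almost every \<open>x\<close>; turning this into almost every point of
  the plane takes a measurable set, which a Borel version of the mixed derivative supplies.\<close>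

lemma L1_complete:
  fixes s :: "nat \<Rightarrow> 'a \<Rightarrow> real"
  assumes s: "\<And>n. integrable M (s n)"
    and cau: "\<And>e. e > 0 \<Longrightarrow> \<exists>N. \<forall>i\<ge>N. \<forall>j\<ge>N. (LINT x|M. \<bar>s i x - s j x\<bar>) < e"
  obtains h where "integrable M h" "(\<lambda>n. \<integral>\<^sup>+x. ennreal \<bar>s n x - h x\<bar> \<partial>M) \<longlonglongrightarrow> 0"
proof -
  note [measurable] = borel_measurable_integrable[OF s]
  obtain r where r: "strict_mono r" "AE x in M. Cauchy (\<lambda>i. s (r i) x)"
    using cauchy_L1_AE_cauchy_subseq[of M s] s cau by (auto simp: real_norm_def)
  define h where "h x = lim (\<lambda>i. s (r i) x)" for x
  have [measurable]: "h \<in> borel_measurable M"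
    unfolding h_def by measurable
  have lim: "AE x in M. (\<lambda>i. s (r i) x) \<longlonglongrightarrow> h x"
    using r(2)
  proof eventually_elim
    case (elim x)
    then show ?case unfolding h_def by (rule Cauchy_convergent[THEN convergent_LIMSEQ_iff[THEN iffD1]])
  qed
  \<comment> \<open>With \<open>n\<close> fixed, the second index of the Cauchy estimate runs
    through the subsequence; Fatou's lemma carries the bound over to the limit
    \<open>h\<close>.\<close>
  have est: "\<exists>N. \<forall>n\<ge>N. (\<integral>\<^sup>+x. ennreal \<bar>s n x - h x\<bar> \<partial>M) \<le> ennreal e" if "e > 0" for e
  proof -
    obtain N where N: "\<forall>i\<ge>N. \<forall>j\<ge>N. (LINT x|M. \<bar>s i x - s j x\<bar>) < e" using cau[OF \<open>e > 0\<close>] by blast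
    have "(\<integral>\<^sup>+x. ennreal \<bar>s n x - h x\<bar> \<partial>M) \<le> ennreal e" if n: "n \<ge> N" for n
    proof -
      have "(\<integral>\<^sup>+x. ennreal \<bar>s n x - h x\<bar> \<partial>M) = (\<integral>\<^sup>+x. liminf (\<lambda>i. ennreal \<bar>s n x - s (r i) x\<bar>) \<partial>M)"
        using lim
      proof (intro nn_integral_cong_AE, eventually_elim)
        case (elim x)
        have "(\<lambda>i. ennreal \<bar>s n x - s (r i) x\<bar>) \<longlonglongrightarrow> ennreal \<bar>s n x - h x\<bar>"
          by (intro tendsto_ennrealI tendsto_intros elim)
        from lim_imp_Liminf[OF sequentially_bot this] show ?case by (rule sym)
      qed
      also have "\<dots> \<le> liminf (\<lambda>i. \<integral>\<^sup>+x. ennreal \<bar>s n x - s (r i) x\<bar> \<partial>M)"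
        by (intro nn_integral_liminf) measurable
      also have "\<dots> \<le> ennreal e"
      proof (rule Liminf_le)
        show "\<forall>\<^sub>F i in sequentially. (\<integral>\<^sup>+x. ennreal \<bar>s n x - s (r i) x\<bar> \<partial>M) \<le> ennreal e"
          using eventually_ge_at_top[of N]
        proof eventually_elim
          case (elim i)
          then have "N \<le> r i" using seq_suble[OF r(1), of i] by linarith
          moreover have "(\<integral>\<^sup>+x. ennreal \<bar>s n x - s (r i) x\<bar> \<partial>M) = ennreal (LINT x|M. \<bar>s n x - s (r i) x\<bar>)"
            by (intro nn_integral_eq_integral) (auto intro!: integrable_abs s Bochner_Integration.integrable_diff)
          ultimately show ?case using N n by (simp add: ennreal_leI less_imp_le)
        qed
      qed simp
      finally show ?thesis .
    qed
    then show ?thesis by blast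
  qed
  have "(\<lambda>n. \<integral>\<^sup>+x. ennreal \<bar>s n x - h x\<bar> \<partial>M) \<longlonglongrightarrow> 0"
  proof (rule order_tendstoI)
    fix a :: ennreal assume "0 < a"
    then obtain e where e: "0 < e" "ennreal e < a"
      using ennreal_rat_dense[of 0 a] by (metis ennreal_0 ennreal_less_iff le_less)
    with est[OF e(1)] show "\<forall>\<^sub>F n in sequentially. (\<integral>\<^sup>+x. ennreal \<bar>s n x - h x\<bar> \<partial>M) < a"
      unfolding eventually_sequentially by (meson le_less_trans)
  qed simp
  moreover have "integrable M h"
  proof -
    obtain n where "(\<integral>\<^sup>+x. ennreal \<bar>s n x - h x\<bar> \<partial>M) \<le> ennreal 1" using est[of 1] by auto
    then have "integrable M (\<lambda>x. s n x - h x)"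
      by (intro integrableI_bounded) (auto simp: order_le_less_trans)
    from Bochner_Integration.integrable_diff[OF s[of n] this] show ?thesis by simp
  qed
  ultimately show ?thesis using that by blast
qed

text \<open>
  The last factor is the Bregman divergence of \<open>u \<mapsto> sqrt (1 + u\<^sup>2)\<close>.  With \<open>p = sqrt (1 + u\<^sup>2)\<close> and
  \<open>q = sqrt (1 + v\<^sup>2)\<close> the bound rests on \<open>(p q)\<^sup>2 - (1 + u v)\<^sup>2 = (u - v)\<^sup>2\<close>.
\<close>

lemma bregman_sqrt:
  fixes u v :: real
  shows "(u - v)\<^sup>2 \<le> 2 * (1 + v\<^sup>2) * sqrt (1 + u\<^sup>2) * (sqrt (1 + u\<^sup>2) - sqrt (1 + v\<^sup>2) - v / sqrt (1 + v\<^sup>2) * (u - v))"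
proof -
  define p q where "p = sqrt (1 + u\<^sup>2)" and "q = sqrt (1 + v\<^sup>2)"
  have pq: "p\<^sup>2 = 1 + u\<^sup>2" "q\<^sup>2 = 1 + v\<^sup>2" "p > 0" "q > 0"
    by (auto simp: p_def q_def add_pos_nonneg)
  \<comment> \<open>Expand and use \<open>q^2 - v^2 = 1\<close>.\<close>
  have B: "q * (p - q - v / q * (u - v)) = p * q - 1 - u * v"
    using pq by (simp add: field_simps power2_eq_square)
  have id: "(p * q)\<^sup>2 - (1 + u * v)\<^sup>2 = (u - v)\<^sup>2"
    by (simp add: power_mult_distrib pq) (simp add: algebra_simps power2_eq_square)
  \<comment> \<open>Cauchy-Schwarz for the vectors (1, u) and (1, v), whose norms are
    \<open>p\<close> and \<open>q\<close>; \<open>id\<close> is the corresponding Lagrange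
    identity.\<close>
  have le: "\<bar>1 + u * v\<bar> \<le> p * q"
  proof -
    have "(1 + u * v)\<^sup>2 \<le> (p * q)\<^sup>2" using id zero_le_power2[of "u - v"] by linarith
    then have "\<bar>1 + u * v\<bar> \<le> \<bar>p * q\<bar>" by (simp only: abs_le_square_iff)
    then show ?thesis using mult_pos_pos[OF pq(3,4)] by linarith
  qed
  have "(u - v)\<^sup>2 = (p * q - 1 - u * v) * (p * q + (1 + u * v))"
    unfolding id[symmetric] by (simp add: algebra_simps power2_eq_square)
  also have "\<dots> \<le> (p * q - 1 - u * v) * (2 * (p * q))"
  proof (rule mult_left_mono)
    show "p * q + (1 + u * v) \<le> 2 * (p * q)" "0 \<le> p * q - 1 - u * v" using le by linarith+
  qed
  also have "\<dots> = 2 * q\<^sup>2 * p * (p - q - v / q * (u - v))"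
    unfolding B[symmetric] by (simp add: power2_eq_square)
  finally show ?thesis unfolding pq(2) unfolding p_def q_def .
qed

text \<open>This is convexity: the graph lies above its tangent at \<open>v\<close>. It is read off
  from \<open>bregman_sqrt\<close>, where the factor in front of the divergence is positive.\<close>

lemma bregman_sqrt_nonneg:
  fixes u v :: real
  shows "0 \<le> sqrt (1 + u\<^sup>2) - sqrt (1 + v\<^sup>2) - v / sqrt (1 + v\<^sup>2) * (u - v)"
proof -
  have "0 \<le> 2 * (1 + v\<^sup>2) * sqrt (1 + u\<^sup>2) * (sqrt (1 + u\<^sup>2) - sqrt (1 + v\<^sup>2) - v / sqrt (1 + v\<^sup>2) * (u - v))"
    using bregman_sqrt[of u v] zero_le_power2[of "u - v"] by linarith
  moreover have "0 < 2 * (1 + v\<^sup>2) * sqrt (1 + u\<^sup>2)"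
    by (intro mult_pos_pos) (auto simp: add_pos_nonneg)
  ultimately show ?thesis by (metis zero_le_mult_iff not_le)
qed

text \<open>If both values are at most \<open>K\<close>, then
  \<open>\<bar>u - v\<bar> \<le> \<eta> + (u - v)^2 / \<eta>\<close>, and the divergence controls
  the square with a constant depending on \<open>K\<close>. If only \<open>u\<close> is large, then
  \<open>\<bar>v\<bar> < \<bar>u\<bar>\<close>, which explains the term
  \<open>2 * \<bar>u\<bar>\<close>. The asymmetry is deliberate: with \<open>v\<close> the coarser
  and \<open>u\<close> the finer quotient, the coarser one is never integrated over a level set of
  the finer one.\<close>

lemma abs_diff_le_bregman:
  fixes u v \<eta> K :: real
  defines "B \<equiv> sqrt (1 + u\<^sup>2) - sqrt (1 + v\<^sup>2) - v / sqrt (1 + v\<^sup>2) * (u - v)"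
  assumes \<eta>: "0 < \<eta>" and K: "0 < K"
  shows "\<bar>u - v\<bar> \<le> \<eta> + 2 * (1 + K\<^sup>2) * sqrt (1 + K\<^sup>2) / \<eta> * B
    + (if K < \<bar>v\<bar> then \<bar>u\<bar> + \<bar>v\<bar> else 0) + (if K < \<bar>u\<bar> then 2 * \<bar>u\<bar> else 0)"
proof -
  have B: "0 \<le> B" unfolding B_def by (rule bregman_sqrt_nonneg)
  have CB: "0 \<le> 2 * (1 + K\<^sup>2) * sqrt (1 + K\<^sup>2) / \<eta> * B"
    using B \<eta> by simp
  show ?thesis
  proof (cases "\<bar>v\<bar> \<le> K \<and> \<bar>u\<bar> \<le> K")
    case True
    then have le: "v\<^sup>2 \<le> K\<^sup>2" "u\<^sup>2 \<le> K\<^sup>2" using K by (auto simp flip: abs_le_square_iff)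
    have "\<bar>u - v\<bar> \<le> \<eta> + (u - v)\<^sup>2 / \<eta>"
    proof (cases "\<bar>u - v\<bar> \<le> \<eta>")
      case False
      then have "\<bar>u - v\<bar> * \<eta> \<le> \<bar>u - v\<bar> * \<bar>u - v\<bar>" by (intro mult_left_mono) auto
      then have "\<bar>u - v\<bar> \<le> (u - v)\<^sup>2 / \<eta>" using \<eta> by (simp add: field_simps power2_eq_square)
      then show ?thesis using \<eta> by linarith
    qed (use \<eta> in \<open>auto intro: order_trans\<close>)
    also have "(u - v)\<^sup>2 \<le> 2 * (1 + v\<^sup>2) * sqrt (1 + u\<^sup>2) * B"
      unfolding B_def by (rule bregman_sqrt)
    also have "\<dots> \<le> 2 * (1 + K\<^sup>2) * sqrt (1 + K\<^sup>2) * B"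
      using le B by (intro mult_right_mono mult_mono) auto
    finally have "\<bar>u - v\<bar> \<le> \<eta> + 2 * (1 + K\<^sup>2) * sqrt (1 + K\<^sup>2) * B / \<eta>"
      using \<eta> by (simp add: divide_right_mono)
    then show ?thesis using True by auto
  qed (use CB \<eta> in auto)
qed

section \<open>Densities of additive set functions along refining partitions\<close>

text \<open>\<open>refine\<close> says at once that the partitions are nested and that the numbers
  \<open>\<nu> n i\<close> come from one additive set function. In \<open>abs_cont\<close> the bound
  \<open>\<delta>\<close> does not depend on the level, which is uniform integrability of the
  quotients in disguise.\<close>

locale refining_partitions = finite_measure M for M :: "'a measure" +
  fixes I :: "nat \<Rightarrow> 'i set" and Q :: "nat \<Rightarrow> 'i \<Rightarrow> 'a set" and \<nu> :: "nat \<Rightarrow> 'i \<Rightarrow> real"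
  assumes fin: "finite (I n)"
    and sets: "i \<in> I n \<Longrightarrow> Q n i \<in> sets M"
    and pos: "i \<in> I n \<Longrightarrow> 0 < measure M (Q n i)"
    and disj: "disjoint_family_on (Q n) (I n)"
    and cover: "(\<Union>i\<in>I n. Q n i) = space M"
    and refine: "n \<le> m \<Longrightarrow> i \<in> I n \<Longrightarrow> \<exists>J\<subseteq>I m. Q n i = (\<Union>j\<in>J. Q m j) \<and> \<nu> n i = (\<Sum>j\<in>J. \<nu> m j)"
    and mesh: "0 < \<delta> \<Longrightarrow> \<exists>n. \<forall>i\<in>I n. measure M (Q n i) < \<delta>"
    and abs_cont: "0 < \<epsilon> \<Longrightarrow> \<exists>\<delta>>0. \<forall>n. \<forall>J\<subseteq>I n. (\<Sum>j\<in>J. measure M (Q n j)) < \<delta> \<longrightarrow> (\<Sum>j\<in>J. \<bar>\<nu> n j\<bar>) < \<epsilon>"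
begin

text \<open>The density of \<open>\<nu>\<close> with respect to \<open>M\<close> on the finite
  algebra of level \<open>n\<close>; along the levels these form the martingale.\<close>

definition quot :: "nat \<Rightarrow> 'a \<Rightarrow> real" where
  "quot n x = (\<Sum>i\<in>I n. \<nu> n i / measure M (Q n i) * indicator (Q n i) x)"

definition level_sets :: "nat \<Rightarrow> 'a set set" where
  "level_sets n = (\<lambda>J. \<Union>j\<in>J. Q n j) ` Pow (I n)"

section \<open>Step functions on the cells and the martingale property\<close>

lemma indicator_UN:
  "J \<subseteq> I n \<Longrightarrow> indicator (\<Union>j\<in>J. Q n j) x = (\<Sum>j\<in>J. indicator (Q n j) x :: real)"
  by (rule indicator_UN_disjoint)
    (auto intro: finite_subset fin disjoint_family_on_mono disj)

text \<open>By disjointness only one summand of \<open>quot\<close> survives on a cell. An arbitrary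
  \<open>g\<close> covers the quotients, their absolute values, the energies and the slopes
  \<open>u / sqrt (1 + u^2)\<close> at once.\<close>

lemma comp_quot_indicator:
  assumes "i \<in> I n"
  shows "g (quot n x) * indicator (Q n i) x = g (\<nu> n i / measure M (Q n i)) * (indicator (Q n i) x :: real)"
proof (cases "x \<in> Q n i")
  case True
  have "quot n x = (\<Sum>j\<in>I n. if j = i then \<nu> n i / measure M (Q n i) else 0)"
    unfolding quot_def
  proof (intro sum.cong refl)
    fix j assume "j \<in> I n"
    then show "\<nu> n j / measure M (Q n j) * indicator (Q n j) x = (if j = i then \<nu> n i / measure M (Q n i) else 0)"
      using disj[of n] True assms by (auto simp: disjoint_family_on_def indicator_def)
  qed
  then show ?thesis using assms fin by simp
qed simp

lemma comp_quot:
  assumes "x \<in> space M"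
  shows "g (quot n x) = (\<Sum>i\<in>I n. g (\<nu> n i / measure M (Q n i)) * (indicator (Q n i) x :: real))"
proof -
  have "g (quot n x) = g (quot n x) * indicator (\<Union>i\<in>I n. Q n i) x"
    using assms by (simp add: cover)
  also have "\<dots> = (\<Sum>i\<in>I n. g (quot n x) * indicator (Q n i) x)"
    by (simp add: indicator_UN sum_distrib_left)
  finally show ?thesis by (simp add: comp_quot_indicator)
qed

lemma integrable_cell[simp]: "i \<in> I n \<Longrightarrow> integrable M (indicator (Q n i) :: _ \<Rightarrow> real)"
  by (intro integrable_real_indicator sets) (auto simp: less_top[symmetric])

lemma cell_Int_space: "i \<in> I n \<Longrightarrow> Q n i \<inter> space M = Q n i"
  using sets.sets_into_space[OF sets] by (simp add: Int_absorb2)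

lemma measure_cell_nonzero: "i \<in> I n \<Longrightarrow> measure M (Q n i) \<noteq> 0"
  using pos by (metis less_irrefl)

lemma integrable_comp_quot[simp]: "integrable M (\<lambda>x. g (quot n x) :: real)"
  by (subst Bochner_Integration.integrable_cong[OF refl comp_quot]) (auto intro!: integrable_sum)

lemma integrable_quot[simp]: "integrable M (quot n)"
  using integrable_comp_quot[of "\<lambda>x. x" n] by simp

lemma measurable_quot[measurable]: "quot n \<in> borel_measurable M"
  by (rule borel_measurable_integrable) simp

lemma sets_level: "A \<in> level_sets n \<Longrightarrow> A \<in> sets M"
  by (auto simp: level_sets_def intro!: sets.finite_UN sets finite_subset[OF _ fin])

lemma integral_comp_quot_UN:
  assumes "J \<subseteq> I n"
  shows "(LINT x:(\<Union>j\<in>J. Q n j)|M. g (quot n x)) = (\<Sum>j\<in>J. g (\<nu> n j / measure M (Q n j)) * measure M (Q n j) :: real)"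
proof -
  have "(LINT x:(\<Union>j\<in>J. Q n j)|M. g (quot n x)) = (LINT x|M. (\<Sum>j\<in>J. g (\<nu> n j / measure M (Q n j)) * indicator (Q n j) x))"
    unfolding set_lebesgue_integral_def
  proof (intro Bochner_Integration.integral_cong refl)
    fix x
    have "indicator (\<Union>j\<in>J. Q n j) x *\<^sub>R g (quot n x) = (\<Sum>j\<in>J. g (quot n x) * indicator (Q n j) x)"
      by (simp add: indicator_UN[OF assms] sum_distrib_right mult.commute[of "g _"])
    also have "\<dots> = (\<Sum>j\<in>J. g (\<nu> n j / measure M (Q n j)) * indicator (Q n j) x)"
      using assms by (intro sum.cong refl comp_quot_indicator) blast
    finally show "indicator (\<Union>j\<in>J. Q n j) x *\<^sub>R g (quot n x) = \<dots>" .
  qed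
  also have "\<dots> = (\<Sum>j\<in>J. g (\<nu> n j / measure M (Q n j)) * measure M (Q n j))"
    using assms by (subst Bochner_Integration.integral_sum) (auto simp: subset_iff cell_Int_space)
  finally show ?thesis .
qed

lemma integral_abs_quot_UN: "J \<subseteq> I n \<Longrightarrow> (LINT x:(\<Union>j\<in>J. Q n j)|M. \<bar>quot n x\<bar>) = (\<Sum>j\<in>J. \<bar>\<nu> n j\<bar>)"
  by (subst integral_comp_quot_UN) (auto simp: abs_divide measure_cell_nonzero subset_iff intro!: sum.cong)

lemma integral_quot_UN: "J \<subseteq> I n \<Longrightarrow> (LINT x:(\<Union>j\<in>J. Q n j)|M. quot n x) = (\<Sum>j\<in>J. \<nu> n j)"
  by (subst integral_comp_quot_UN[of _ _ "\<lambda>x. x"]) (auto simp: measure_cell_nonzero subset_iff intro!: sum.cong)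

text \<open>The martingale property: a coarse cell splits into cells of level \<open>m\<close>, over
  which the integrals add up by \<open>refine\<close>.\<close>

lemma integral_quot_cell:
  assumes "n \<le> m" "i \<in> I n"
  shows "(LINT x:Q n i|M. quot m x) = \<nu> n i"
  using refine[OF assms] integral_quot_UN by auto

lemma comp_quot_mult:
  assumes "x \<in> space M"
  shows "g (quot n x) * quot k x = (\<Sum>i\<in>I n. g (\<nu> n i / measure M (Q n i)) * (indicator (Q n i) x * quot k x))"
  by (subst comp_quot[OF assms]) (simp add: sum_distrib_right mult.assoc)

lemma integrable_indicator_quot: "i \<in> I n \<Longrightarrow> integrable M (\<lambda>x. indicator (Q n i) x * quot k x)"
  using integrable_mult_indicator[OF sets integrable_quot[of k]] by simp

lemma integrable_comp_quot_mult: "integrable M (\<lambda>x. g (quot n x) * quot k x)"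
  by (subst Bochner_Integration.integrable_cong[OF refl comp_quot_mult])
    (auto intro!: integrable_sum integrable_indicator_quot)

text \<open>The factor \<open>g (quot n x)\<close> is constant on the cells of level
  \<open>n\<close>, where the martingale property applies. The value is the same for every
  \<open>k \<ge> n\<close>, and this yields orthogonality.\<close>

lemma integral_comp_quot_mult:
  assumes "n \<le> k"
  shows "(LINT x|M. g (quot n x) * quot k x) = (\<Sum>i\<in>I n. g (\<nu> n i / measure M (Q n i)) * \<nu> n i)" (is "_ = ?r")
proof -
  have "(LINT x|M. g (quot n x) * quot k x) = (LINT x|M. (\<Sum>i\<in>I n. g (\<nu> n i / measure M (Q n i)) * (indicator (Q n i) x * quot k x)))"
    by (intro Bochner_Integration.integral_cong refl comp_quot_mult)
  also have "\<dots> = (\<Sum>i\<in>I n. g (\<nu> n i / measure M (Q n i)) * (LINT x:Q n i|M. quot k x))"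
    by (subst Bochner_Integration.integral_sum) (auto simp: set_lebesgue_integral_def integrable_indicator_quot)
  also have "\<dots> = ?r"
    by (intro sum.cong refl) (simp add: integral_quot_cell[OF assms])
  finally show ?thesis .
qed

text \<open>Orthogonality of martingale increments to functions of the past.\<close>

lemma integral_comp_quot_mult_diff:
  assumes "n \<le> m"
  shows "(LINT x|M. g (quot n x) * (quot m x - quot n x)) = 0"
  using integral_comp_quot_mult[OF assms] integral_comp_quot_mult[OF order_refl]
  by (simp add: right_diff_distrib integrable_comp_quot_mult)

section \<open>Uniform integrability and energies\<close>

lemma level_sets_mono:
  assumes "n \<le> m" "A \<in> level_sets n"
  shows "A \<in> level_sets m"
proof -
  obtain J where J: "J \<subseteq> I n" "A = (\<Union>j\<in>J. Q n j)" using assms(2) by (auto simp: level_sets_def)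
  have "\<forall>i\<in>J. \<exists>K\<subseteq>I m. Q n i = (\<Union>j\<in>K. Q m j)"
  proof
    fix i assume "i \<in> J"
    then have "i \<in> I n" using J(1) by blast
    from refine[OF assms(1) this] show "\<exists>K\<subseteq>I m. Q n i = (\<Union>j\<in>K. Q m j)" by metis
  qed
  then obtain K where K: "\<And>i. i \<in> J \<Longrightarrow> K i \<subseteq> I m \<and> Q n i = (\<Union>j\<in>K i. Q m j)" by metis
  then have "A = (\<Union>j\<in>(\<Union>i\<in>J. K i). Q m j)" "(\<Union>i\<in>J. K i) \<subseteq> I m" using J by auto
  then show ?thesis unfolding level_sets_def by (intro image_eqI[where x = "\<Union>i\<in>J. K i"]) auto
qed

text \<open>Since \<open>quot n\<close> is constant on cells, the sets where it is large are unions
  of cells, hence accessible to \<open>abs_cont_integral\<close>.\<close>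

lemma level_set_quot: "{x \<in> space M. P (quot n x)} \<in> level_sets n"
proof -
  have 1: "quot n x = \<nu> n i / measure M (Q n i)" if "x \<in> Q n i" "i \<in> I n" for x i
    using comp_quot_indicator[OF that(2), of "\<lambda>x. x" x] that(1) by simp
  have "{x \<in> space M. P (quot n x)} = (\<Union>i\<in>{i\<in>I n. P (\<nu> n i / measure M (Q n i))}. Q n i)"
    by (auto simp: 1 cover[of n, symmetric])
  then show ?thesis by (auto simp: level_sets_def)
qed

text \<open>On a union of cells, the measure and the integral of \<open>\<bar>quot n\<bar>\<close>
  are exactly the two sums in \<open>abs_cont\<close>. One \<open>\<delta>\<close> serves all
  levels.\<close>

lemma abs_cont_integral:
  assumes "0 < \<epsilon>"
  obtains \<delta> where "0 < \<delta>" "\<And>n A. A \<in> level_sets n \<Longrightarrow> measure M A < \<delta> \<Longrightarrow> (LINT x:A|M. \<bar>quot n x\<bar>) < \<epsilon>"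
proof -
  obtain \<delta> where \<delta>: "\<delta> > 0" "\<And>n J. J \<subseteq> I n \<Longrightarrow> (\<Sum>j\<in>J. measure M (Q n j)) < \<delta> \<Longrightarrow> (\<Sum>j\<in>J. \<bar>\<nu> n j\<bar>) < \<epsilon>"
    using abs_cont[OF assms] by blast
  have "(LINT x:A|M. \<bar>quot n x\<bar>) < \<epsilon>" if A: "A \<in> level_sets n" "measure M A < \<delta>" for n A
  proof -
    obtain J where J: "J \<subseteq> I n" "A = (\<Union>j\<in>J. Q n j)" using A(1) by (auto simp: level_sets_def)
    have "measure M A = (\<Sum>j\<in>J. measure M (Q n j))"
      unfolding J(2)
    proof (rule finite_measure_finite_Union)
      show "finite J" using J(1) fin by (rule finite_subset)
      show "Q n ` J \<subseteq> sets M" using J(1) sets by blast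
      show "disjoint_family_on (Q n) J" using J(1) disj by (rule disjoint_family_on_mono)
    qed
    with A(2) \<delta>(2)[OF J(1)] show ?thesis by (simp add: J(2) integral_abs_quot_UN[OF J(1)])
  qed
  with \<delta>(1) show ?thesis using that by blast
qed

text \<open>Absolute continuity implies bounded variation: cells of level \<open>N\<close> are
  chosen so small that each carries variation at most 1, and there are finitely many of them. Adding
  1 to their number keeps \<open>V\<close> positive.\<close>

lemma quot_L1_bounded:
  obtains V N where "0 < V" "\<And>n. N \<le> n \<Longrightarrow> (LINT x|M. \<bar>quot n x\<bar>) \<le> V"
proof -
  obtain \<delta> where \<delta>: "\<delta> > 0" "\<And>n A. A \<in> level_sets n \<Longrightarrow> measure M A < \<delta> \<Longrightarrow> (LINT x:A|M. \<bar>quot n x\<bar>) < 1"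
    using abs_cont_integral[of 1] by auto
  obtain N where N: "\<And>i. i \<in> I N \<Longrightarrow> measure M (Q N i) < \<delta>" using mesh[OF \<delta>(1)] by blast
  have "(LINT x|M. \<bar>quot n x\<bar>) \<le> real (card (I N)) + 1" if n: "N \<le> n" for n
  proof -
    have "(LINT x|M. \<bar>quot n x\<bar>) = (LINT x|M. (\<Sum>i\<in>I N. indicator (Q N i) x * \<bar>quot n x\<bar>))"
      by (intro Bochner_Integration.integral_cong refl)
        (simp flip: sum_distrib_right indicator_UN add: cover)
    also have "\<dots> = (\<Sum>i\<in>I N. (LINT x:Q N i|M. \<bar>quot n x\<bar>))"
      using integrable_mult_indicator[OF sets integrable_comp_quot[of abs n]]
      by (subst Bochner_Integration.integral_sum) (auto simp: set_lebesgue_integral_def)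
    also have "\<dots> \<le> (\<Sum>i\<in>I N. 1)"
    proof (rule sum_mono)
      fix i assume i: "i \<in> I N"
      have "Q N i \<in> level_sets N" unfolding level_sets_def using i by (intro image_eqI[of _ _ "{i}"]) auto
      then show "(LINT x:Q N i|M. \<bar>quot n x\<bar>) \<le> 1"
        using \<delta>(2)[OF level_sets_mono[OF n] N[OF i]] by simp
    qed
    finally show ?thesis by simp
  qed
  then show ?thesis using that[of "real (card (I N)) + 1" N] by auto
qed

text \<open>The linear term of the divergence is a martingale increment times a function of the
  past, so its integral vanishes; what remains is the gain of energy from level \<open>n\<close> to
  level \<open>m\<close>.\<close>

lemma integral_bregman:
  fixes n m
  defines "B \<equiv> \<lambda>x. sqrt (1 + (quot m x)\<^sup>2) - sqrt (1 + (quot n x)\<^sup>2)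
    - quot n x / sqrt (1 + (quot n x)\<^sup>2) * (quot m x - quot n x)"
  assumes "n \<le> m"
  shows "integrable M B"
    and "(LINT x|M. B x) = (LINT x|M. sqrt (1 + (quot m x)\<^sup>2)) - (LINT x|M. sqrt (1 + (quot n x)\<^sup>2))"
proof -
  have i: "integrable M (\<lambda>x. sqrt (1 + (quot k x)\<^sup>2))" for k
    by (rule integrable_comp_quot)
  have j: "integrable M (\<lambda>x. quot n x / sqrt (1 + (quot n x)\<^sup>2) * (quot m x - quot n x))"
    using integrable_comp_quot_mult[of "\<lambda>u. u / sqrt (1 + u\<^sup>2)" n] by (simp add: right_diff_distrib)
  show "integrable M B" unfolding B_def by (intro Bochner_Integration.integrable_diff i j)
  show "(LINT x|M. B x) = (LINT x|M. sqrt (1 + (quot m x)\<^sup>2)) - (LINT x|M. sqrt (1 + (quot n x)\<^sup>2))"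
    unfolding B_def using integral_comp_quot_mult_diff[OF assms(2), of "\<lambda>u. u / sqrt (1 + u\<^sup>2)"]
    by (simp only: Bochner_Integration.integral_diff Bochner_Integration.integrable_diff i j diff_0_right)
qed

lemma energy_mono:
  assumes "n \<le> m"
  shows "(LINT x|M. sqrt (1 + (quot n x)\<^sup>2)) \<le> (LINT x|M. sqrt (1 + (quot m x)\<^sup>2))"
proof -
  have "0 \<le> (LINT x|M. sqrt (1 + (quot m x)\<^sup>2) - sqrt (1 + (quot n x)\<^sup>2)
    - quot n x / sqrt (1 + (quot n x)\<^sup>2) * (quot m x - quot n x))"
    by (intro integral_nonneg_AE AE_I2 bregman_sqrt_nonneg)
  then show ?thesis using integral_bregman(2)[OF assms] by simp
qed

text \<open>Increasing bounded energies have small gains, a gain is an integrated divergence, and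
  \<open>abs_diff_le_bregman\<close> converts the divergence into an L^1 distance up to
  tails.\<close>

lemma quot_Cauchy:
  assumes "0 < e"
  shows "\<exists>N. \<forall>n\<ge>N. \<forall>m\<ge>N. (LINT x|M. \<bar>quot n x - quot m x\<bar>) < e"
proof -
  obtain V N where V: "0 < V" "\<And>n. N \<le> n \<Longrightarrow> (LINT x|M. \<bar>quot n x\<bar>) \<le> V"
    using quot_L1_bounded by blast
  define E where "E n = (LINT x|M. sqrt (1 + (quot n x)\<^sup>2))" for n
  have mono: "E n \<le> E m" if "n \<le> m" for n m
    unfolding E_def using that by (rule energy_mono)
  have "E n \<le> measure M (space M) + V" for n
  proof -
    \<comment> \<open>The L^1 bound is available only from level \<open>N\<close> on; monotonicity
      extends the energy bound to the earlier levels.\<close>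
    have "E n \<le> E (max n N)" by (rule mono) simp
    also have "\<dots> \<le> (LINT x|M. 1 + \<bar>quot (max n N) x\<bar>)"
      unfolding E_def
    proof (intro integral_mono integrable_comp_quot)
      fix x show "sqrt (1 + (quot (max n N) x)\<^sup>2) \<le> 1 + \<bar>quot (max n N) x\<bar>"
        by (rule real_le_lsqrt) (auto simp: power2_eq_square algebra_simps)
    qed
    also have "\<dots> = measure M (space M) + (LINT x|M. \<bar>quot (max n N) x\<bar>)"
      using integrable_comp_quot[of abs "max n N"] by (subst Bochner_Integration.integral_add) auto
    also have "\<dots> \<le> measure M (space M) + V"
      using V(2)[of "max n N"] by simp
    finally show ?thesis .
  qed
  then have "Cauchy E"
    by (intro LIMSEQ_imp_Cauchy[OF LIMSEQ_incseq_SUP]) (auto intro!: bdd_aboveI incseq_def[THEN iffD2] mono)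
  define \<eta> where "\<eta> = e / (4 * (measure M (space M) + 1))"
  have \<eta>: "0 < \<eta>" "\<eta> * measure M (space M) \<le> e / 4"
  proof -
    have "0 < measure M (space M) + 1" by (simp add: add_nonneg_pos)
    then show "0 < \<eta>" "\<eta> * measure M (space M) \<le> e / 4"
      unfolding \<eta>_def using assms by (auto simp: divide_simps mult_less_0_iff algebra_simps)
  qed
  have e8: "0 < e / 8" using assms by simp
  obtain \<delta> where \<delta>: "0 < \<delta>" "\<And>n A. A \<in> level_sets n \<Longrightarrow> measure M A < \<delta> \<Longrightarrow> (LINT x:A|M. \<bar>quot n x\<bar>) < e / 8"
    using abs_cont_integral[OF e8] by blast
  \<comment> \<open>By Markov's inequality \<open>\<bar>quot n\<bar> > K\<close> has measure at most
    \<open>V / K\<close>; the choice \<open>V + 1\<close> makes this strictly less than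
    \<open>\<delta>\<close>.\<close>
  define K where "K = (V + 1) / \<delta>"
  have K: "0 < K" "V < K * \<delta>" using V(1) \<delta>(1) by (auto simp: K_def)
  define A where "A n = {x \<in> space M. K < \<bar>quot n x\<bar>}" for n
  have A: "A n \<in> level_sets n" for n unfolding A_def by (rule level_set_quot)
  have [measurable]: "A n \<in> sets M" for n using A by (rule sets_level)
  \<comment> \<open>The level set is formed at level \<open>n\<close> but remains a union of cells
    at the finer level \<open>m\<close>, so uniform integrability applies to \<open>quot m\<close>
    on it.\<close>
  have tail: "(LINT x:A n|M. \<bar>quot m x\<bar>) < e / 8" if "N \<le> n" "n \<le> m" for n m
  proof (rule \<delta>(2)[OF level_sets_mono[OF that(2) A]])
    have "measure M (A n) * K = (LINT x|M. indicator (A n) x * K)"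
      using sets.sets_into_space[of "A n" M] by (simp add: Int_absorb2)
    also have "\<dots> \<le> (LINT x|M. \<bar>quot n x\<bar>)"
    proof (rule integral_mono)
      show "integrable M (\<lambda>x. indicator (A n) x * K)"
        by (intro integrable_mult_left integrable_real_indicator) (auto simp: less_top[symmetric])
    qed (auto simp: A_def indicator_def)
    also have "\<dots> < K * \<delta>" using V(2)[OF that(1)] K(2) by simp
    finally show "measure M (A n) < \<delta>" using K(1) by (simp add: mult.commute)
  qed
  \<comment> \<open>The factor of the divergence in \<open>abs_diff_le_bregman\<close>. It is fixed
    before \<open>N'\<close>, so that the energy gain can be made small relative to it.\<close>
  define C where "C = 2 * (1 + K\<^sup>2) * sqrt (1 + K\<^sup>2) / \<eta>"
  have C: "0 \<le> C" using \<eta>(1) by (simp add: C_def)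
  obtain N' where N': "\<And>n m. N' \<le> n \<Longrightarrow> N' \<le> m \<Longrightarrow> \<bar>E m - E n\<bar> < e / (4 * (C + 1))"
  proof -
    have "0 < e / (4 * (C + 1))" using assms C by simp
    from CauchyD[OF \<open>Cauchy E\<close> this] obtain N' where "\<forall>m\<ge>N'. \<forall>n\<ge>N'. norm (E m - E n) < e / (4 * (C + 1))"
      by blast
    then show ?thesis using that[of N'] unfolding real_norm_def by blast
  qed
  have main: "(LINT x|M. \<bar>quot m x - quot n x\<bar>) < e" if "N \<le> n" "N' \<le> n" "n \<le> m" for n m
  proof -
    define B where "B x = sqrt (1 + (quot m x)\<^sup>2) - sqrt (1 + (quot n x)\<^sup>2)
      - quot n x / sqrt (1 + (quot n x)\<^sup>2) * (quot m x - quot n x)" for x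
    have B: "integrable M B" "(LINT x|M. B x) = E m - E n"
      using integral_bregman[OF that(3)] by (auto simp: B_def[abs_def] E_def)
    have ind: "integrable M (\<lambda>x. indicator (A k) x * \<bar>quot l x\<bar>)" for k l
      using integrable_mult_indicator[OF _ integrable_comp_quot[of abs l], of "A k"] by simp
    have "(LINT x|M. \<bar>quot m x - quot n x\<bar>)
      \<le> (LINT x|M. \<eta> + C * B x + indicator (A n) x * \<bar>quot m x\<bar> + indicator (A n) x * \<bar>quot n x\<bar>
          + 2 * (indicator (A m) x * \<bar>quot m x\<bar>))"
    proof (rule integral_mono)
      fix x assume x: "x \<in> space M"
      have "\<bar>quot m x - quot n x\<bar> \<le> \<eta> + C * B x + (if K < \<bar>quot n x\<bar> then \<bar>quot m x\<bar> + \<bar>quot n x\<bar> else 0)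
        + (if K < \<bar>quot m x\<bar> then 2 * \<bar>quot m x\<bar> else 0)"
        unfolding B_def C_def using \<eta>(1) K(1) by (intro abs_diff_le_bregman) auto
      then show "\<bar>quot m x - quot n x\<bar> \<le> \<eta> + C * B x + indicator (A n) x * \<bar>quot m x\<bar>
          + indicator (A n) x * \<bar>quot n x\<bar> + 2 * (indicator (A m) x * \<bar>quot m x\<bar>)"
        using x by (auto simp: A_def split: if_splits)
    qed (auto intro!: Bochner_Integration.integrable_add integrable_abs Bochner_Integration.integrable_diff B ind)
    also have "\<dots> = \<eta> * measure M (space M) + C * (E m - E n) + (LINT x:A n|M. \<bar>quot m x\<bar>)
      + (LINT x:A n|M. \<bar>quot n x\<bar>) + 2 * (LINT x:A m|M. \<bar>quot m x\<bar>)"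
      by (simp add: B ind set_lebesgue_integral_def)
    \<comment> \<open>The shares belong, in order, to the threshold \<open>\<eta>\<close>, the
      energy gain, the tails of both quotients over \<open>A n\<close>, and twice the tail of
      \<open>quot m\<close> over \<open>A m\<close>.\<close>
    also have "\<dots> < e / 4 + e / 4 + e / 8 + e / 8 + 2 * (e / 8)"
    proof -
      have "C * (E m - E n) \<le> C * (e / (4 * (C + 1)))"
        using N'[of n m] that C by (intro mult_left_mono) auto
      also have "\<dots> \<le> e / 4" using assms C by (simp add: field_simps)
      finally have "C * (E m - E n) \<le> e / 4" .
      moreover have "N \<le> m" using that by simp
      ultimately show ?thesis
        using \<eta>(2) tail[OF that(1,3)] tail[OF that(1) order_refl] tail[OF _ order_refl, of m] by linarith
    qed
    finally show ?thesis by simp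
  qed
  show ?thesis
  proof (intro exI[of _ "max N N'"] allI impI)
    fix n m assume "max N N' \<le> n" "max N N' \<le> m"
    then show "(LINT x|M. \<bar>quot n x - quot m x\<bar>) < e"
      using main[of n m] main[of m n] by (cases "n \<le> m") (auto simp: abs_minus_commute)
  qed
qed

text \<open>L^1 convergence passes to the integral over a fixed cell, and there the sequence of
  integrals is constant from level \<open>n\<close> on by the martingale property.\<close>

lemma density_exists:
  obtains h where "integrable M h" "\<And>n i. i \<in> I n \<Longrightarrow> (LINT x:Q n i|M. h x) = \<nu> n i"
proof -
  obtain h where h: "integrable M h" "(\<lambda>n. \<integral>\<^sup>+x. ennreal \<bar>quot n x - h x\<bar> \<partial>M) \<longlonglongrightarrow> 0"
    using L1_complete[of M quot, OF integrable_quot quot_Cauchy] by blast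
  note [measurable] = borel_measurable_integrable[OF h(1)]
  have "(LINT x:Q n i|M. h x) = \<nu> n i" if i: "i \<in> I n" for n i
  proof -
    note [measurable] = sets[OF i]
    have lim: "(\<lambda>k. LINT x|M. indicator (Q n i) x *\<^sub>R quot k x) \<longlonglongrightarrow> (LINT x|M. indicator (Q n i) x *\<^sub>R h x)"
    proof (rule tendsto_L1_int)
      show "integrable M (\<lambda>x. indicator (Q n i) x *\<^sub>R quot k x)" for k
        by (intro integrable_mult_indicator sets i integrable_quot)
      show "integrable M (\<lambda>x. indicator (Q n i) x *\<^sub>R h x)"
        by (intro integrable_mult_indicator sets i h)
      show "(\<lambda>k. \<integral>\<^sup>+x. ennreal (norm (indicator (Q n i) x *\<^sub>R quot k x - indicator (Q n i) x *\<^sub>R h x)) \<partial>M) \<longlonglongrightarrow> 0"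
        by (rule tendsto_sandwich[OF _ _ tendsto_const h(2)])
          (auto intro!: always_eventually nn_integral_mono ennreal_leI simp: indicator_def)
    qed
    have "\<forall>\<^sub>F k in sequentially. (LINT x|M. indicator (Q n i) x *\<^sub>R quot k x) = \<nu> n i"
      using eventually_ge_at_top[of n]
      by eventually_elim (simp add: integral_quot_cell[OF _ i, unfolded set_lebesgue_integral_def, simplified])
    from LIMSEQ_unique[OF lim tendsto_eventually[OF this]] show ?thesis
      unfolding set_lebesgue_integral_def .
  qed
  with h(1) show ?thesis using that by blast
qed

end

section \<open>Densities of absolutely continuous functions on a rectangle\<close>

lemma rect_increment_cbox:
  assumes "x1 \<le> x2" "y1 \<le> y2"
  shows "rect_increment f (cbox (x1, y1) (x2, y2)) = f (x2, y2) - f (x1, y2) - f (x2, y1) + f (x1, y1)"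
proof -
  have "interval_lowerbound (cbox (x1, y1) (x2, y2)) = (x1, y1)"
    "interval_upperbound (cbox (x1, y1) (x2, y2)) = (x2, y2)"
    using assms by (subst interval_lowerbound interval_upperbound, auto simp: Basis_prod_def)+
  then show ?thesis by (simp add: rect_increment_def)
qed

lemma measure_cbox_real_pair:
  fixes x1 x2 y1 y2 :: real
  assumes "x1 \<le> x2" "y1 \<le> y2"
  shows "measure lborel (cbox (x1, y1) (x2, y2)) = (x2 - x1) * (y2 - y1)"
  using assms by (simp add: content_Pair)

lemma atLeastLessThan_UN_steps:
  fixes t :: "nat \<Rightarrow> real"
  assumes "mono t" "p \<le> q"
  shows "{t p..<t q} = (\<Union>i\<in>{p..<q}. {t i..<t (Suc i)})"
  using assms(2)
proof (induction q rule: dec_induct)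
  case (step n)
  have "{t p..<t (Suc n)} = {t p..<t n} \<union> {t n..<t (Suc n)}"
    using step.hyps by (intro ivl_disj_un_two(3)[symmetric] monoD[OF assms(1)]) auto
  then show ?case using step by (auto simp: atLeastLessThanSuc)
qed simp

text \<open>The increment of a cell is a difference in \<open>j\<close> of differences in
  \<open>i\<close>, so the sum telescopes in each index.\<close>

lemma sum_increments:
  fixes g :: "nat \<Rightarrow> nat \<Rightarrow> real"
  assumes "p \<le> q" "r \<le> s"
  shows "(\<Sum>(i, j)\<in>{p..<q} \<times> {r..<s}. g (Suc i) (Suc j) - g i (Suc j) - g (Suc i) j + g i j)
    = g q s - g p s - g q r + g p r"
proof -
  have "(\<Sum>(i, j)\<in>{p..<q} \<times> {r..<s}. g (Suc i) (Suc j) - g i (Suc j) - g (Suc i) j + g i j)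
    = (\<Sum>i\<in>{p..<q}. \<Sum>j\<in>{r..<s}. (g (Suc i) (Suc j) - g i (Suc j)) - (g (Suc i) j - g i j))"
    by (simp add: sum.cartesian_product algebra_simps)
  also have "\<dots> = (\<Sum>i\<in>{p..<q}. (g (Suc i) s - g (Suc i) r) - (g i s - g i r))"
    by (intro sum.cong refl, subst sum_Suc_diff'[OF assms(2), of "\<lambda>j. g (Suc _) j - g _ j"]) simp
  also have "\<dots> = g q s - g p s - g q r + g p r"
    by (subst sum_Suc_diff'[OF assms(1), of "\<lambda>i. g i s - g i r"]) simp
  finally show ?thesis .
qed

text \<open>The first clause of \<open>abs_continuous_on_rect\<close>, separated because the density
  is built from increments alone.\<close>

definition rect_abs_cont :: "real \<Rightarrow> real \<Rightarrow> real \<Rightarrow> real \<Rightarrow> (real \<times> real \<Rightarrow> real) \<Rightarrow> bool" where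
  "rect_abs_cont a b c d f \<longleftrightarrow>
    (\<forall>\<epsilon>>0. \<exists>\<delta>>0. \<forall>D. D division_of \<Union>D \<and> \<Union>D \<subseteq> {a..b} \<times> {c..d} \<and> (\<Sum>K\<in>D. measure lborel K) < \<delta> \<longrightarrow>
      (\<Sum>K\<in>D. \<bar>rect_increment f K\<bar>) < \<epsilon>)"

lemma rect_abs_cont_small:
  assumes "rect_abs_cont a b c d f" "0 < \<epsilon>"
  obtains \<delta> where "0 < \<delta>" "\<And>x1 x2 y1 y2. \<lbrakk>a \<le> x1; x1 \<le> x2; x2 \<le> b; c \<le> y1; y1 \<le> y2; y2 \<le> d;
    (x2 - x1) * (y2 - y1) < \<delta>\<rbrakk> \<Longrightarrow> \<bar>f (x2, y2) - f (x1, y2) - f (x2, y1) + f (x1, y1)\<bar> < \<epsilon>"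
proof -
  obtain \<delta> where \<delta>: "\<delta> > 0" "\<And>D. \<lbrakk>D division_of \<Union>D; \<Union>D \<subseteq> {a..b} \<times> {c..d}; (\<Sum>K\<in>D. measure lborel K) < \<delta>\<rbrakk> \<Longrightarrow>
      (\<Sum>K\<in>D. \<bar>rect_increment f K\<bar>) < \<epsilon>"
    using assms unfolding rect_abs_cont_def by metis
  have "\<bar>f (x2, y2) - f (x1, y2) - f (x2, y1) + f (x1, y1)\<bar> < \<epsilon>"
    if "a \<le> x1" "x1 \<le> x2" "x2 \<le> b" "c \<le> y1" "y1 \<le> y2" "y2 \<le> d" "(x2 - x1) * (y2 - y1) < \<delta>" for x1 x2 y1 y2
  proof -
    have "cbox (x1, y1) (x2, y2) \<noteq> {}" using that by (simp add: cbox_Pair_eq)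
    then have div: "{cbox (x1, y1) (x2, y2)} division_of \<Union>{cbox (x1, y1) (x2, y2)}"
      using division_of_self by simp
    have "{x1..x2} \<times> {y1..y2} \<subseteq> {a..b} \<times> {c..d}"
      using that by (intro Sigma_mono) auto
    then have "\<Union>{cbox (x1, y1) (x2, y2)} \<subseteq> {a..b} \<times> {c..d}" by (simp add: cbox_Pair_eq)
    moreover have "(\<Sum>K\<in>{cbox (x1, y1) (x2, y2)}. measure lborel K) < \<delta>"
      using that(7) by (simp add: measure_cbox_real_pair[OF that(2,5)])
    ultimately have "(\<Sum>K\<in>{cbox (x1, y1) (x2, y2)}. \<bar>rect_increment f K\<bar>) < \<epsilon>"
      by (rule \<delta>(2)[OF div])
    then show ?thesis by (simp add: rect_increment_cbox[OF that(2,5)])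
  qed
  with \<delta>(1) show ?thesis using that by blast
qed

text \<open>Moving from \<open>(x, y)\<close> to \<open>(x', y')\<close> changes the function by the
  increments over two thin rectangles, one between \<open>x\<close> and \<open>x'\<close> above the
  side \<open>c\<close>, the other between \<open>y\<close> and \<open>y'\<close> next to the side
  \<open>a\<close>. Both have small area.\<close>

lemma continuous_on_increment:
  assumes ac: "rect_abs_cont a b c d f"
  shows "continuous_on ({a..b} \<times> {c..d}) (\<lambda>(x, y). f (x, y) - f (x, c) - f (a, y) + f (a, c))"
    (is "continuous_on _ ?F")
  unfolding continuous_on_iff
proof (intro ballI allI impI)
  fix p \<epsilon> assume p: "p \<in> {a..b} \<times> {c..d}" and \<epsilon>: "0 < (\<epsilon>::real)"
  obtain x y where xy: "p = (x, y)" "a \<le> x" "x \<le> b" "c \<le> y" "y \<le> d" using p by auto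
  have "0 < \<epsilon> / 2" using \<epsilon> by simp
  from rect_abs_cont_small[OF ac this] obtain \<delta> where \<delta>: "0 < \<delta>"
    "\<And>x1 x2 y1 y2. \<lbrakk>a \<le> x1; x1 \<le> x2; x2 \<le> b; c \<le> y1; y1 \<le> y2; y2 \<le> d;
    (x2 - x1) * (y2 - y1) < \<delta>\<rbrakk> \<Longrightarrow> \<bar>f (x2, y2) - f (x1, y2) - f (x2, y1) + f (x1, y1)\<bar> < \<epsilon> / 2" by blast
  \<comment> \<open>The long side of either rectangle is at most \<open>b - a + (d - c)\<close>, so
    a short side below \<open>r\<close> forces an area below \<open>\<delta>\<close>; the summand 1
    keeps the denominator positive.\<close>
  define r where "r = \<delta> / (b - a + (d - c) + 1)"
  have den: "0 < b - a + (d - c) + 1" using xy by linarith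
  have r: "0 < r" using den \<delta>(1) by (simp add: r_def)
  have small: "u * v < \<delta>" if "u < r" "0 \<le> u" "0 \<le> v" "v \<le> b - a + (d - c)" for u v
  proof -
    have "u * v \<le> u * (b - a + (d - c) + 1)" using that by (intro mult_left_mono) auto
    also have "\<dots> < r * (b - a + (d - c) + 1)" using that den by (intro mult_strict_right_mono) auto
    also have "\<dots> = \<delta>" using den by (simp add: r_def)
    finally show ?thesis .
  qed
  show "\<exists>e>0. \<forall>p'\<in>{a..b} \<times> {c..d}. dist p' p < e \<longrightarrow> dist (?F p') (?F p) < \<epsilon>"
  proof (intro exI[of _ r] conjI ballI impI r)
    fix p' assume p': "p' \<in> {a..b} \<times> {c..d}" "dist p' p < r"
    obtain x' y' where xy': "p' = (x', y')" "a \<le> x'" "x' \<le> b" "c \<le> y'" "y' \<le> d" using p'(1) by auto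
    have dx: "\<bar>x' - x\<bar> < r" and dy: "\<bar>y' - y\<bar> < r"
      using p'(2) dist_fst_le[of p' p] dist_snd_le[of p' p] xy(1) xy'(1) by (auto simp: dist_real_def)
    have 1: "\<bar>(f (x', y') - f (x', c)) - (f (x, y') - f (x, c))\<bar> < \<epsilon> / 2"
    proof (cases "x \<le> x'")
      case True
      have "\<bar>f (x', y') - f (x, y') - f (x', c) + f (x, c)\<bar> < \<epsilon> / 2"
        using True xy xy' dx by (intro \<delta>(2) small) auto
      then show ?thesis by linarith
    next
      case False
      have "\<bar>f (x, y') - f (x', y') - f (x, c) + f (x', c)\<bar> < \<epsilon> / 2"
        using False xy xy' dx by (intro \<delta>(2) small) auto
      then show ?thesis by linarith
    qed
    have 2: "\<bar>(f (x, y') - f (a, y')) - (f (x, y) - f (a, y))\<bar> < \<epsilon> / 2"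
    proof (cases "y \<le> y'")
      case True
      have "\<bar>f (x, y') - f (a, y') - f (x, y) + f (a, y)\<bar> < \<epsilon> / 2"
        using True xy xy' dy small[of "y' - y" "x - a"] by (intro \<delta>(2)) (auto simp: mult.commute)
      then show ?thesis by linarith
    next
      case False
      have "\<bar>f (x, y) - f (a, y) - f (x, y') + f (a, y')\<bar> < \<epsilon> / 2"
        using False xy xy' dy small[of "y - y'" "x - a"] by (intro \<delta>(2)) (auto simp: mult.commute)
      then show ?thesis by linarith
    qed
    show "dist (?F p') (?F p) < \<epsilon>"
      unfolding xy(1) xy'(1) dist_real_def prod.case using 1 2 by linarith
  qed
qed

lemma abs_continuous_on_imp_continuous_on:
  assumes "abs_continuous_on {a..b} g"
  shows "continuous_on {a..b} g"
  unfolding continuous_on_iff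
proof (intro ballI allI impI)
  fix x \<epsilon> :: real assume x: "x \<in> {a..b}" and \<epsilon>: "0 < \<epsilon>"
  obtain \<delta> where \<delta>: "\<delta> > 0" "\<And>D. \<lbrakk>D division_of \<Union>D; \<Union>D \<subseteq> {a..b}; (\<Sum>K\<in>D. measure lborel K) < \<delta>\<rbrakk> \<Longrightarrow>
      (\<Sum>K\<in>D. \<bar>g (interval_upperbound K) - g (interval_lowerbound K)\<bar>) < \<epsilon>"
    using assms \<epsilon> unfolding abs_continuous_on_def by metis
  have *: "\<bar>g v - g u\<bar> < \<epsilon>" if "a \<le> u" "u \<le> v" "v \<le> b" "v - u < \<delta>" for u v
  proof -
    have "{{u..v}} division_of \<Union>{{u..v}}"
      using division_of_self[of u v] that by (simp add: cbox_interval)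
    from \<delta>(2)[OF this] show ?thesis
      using that interval_upperbound[of u v] interval_lowerbound[of u v] by (simp add: cbox_interval)
  qed
  show "\<exists>e>0. \<forall>x'\<in>{a..b}. dist x' x < e \<longrightarrow> dist (g x') (g x) < \<epsilon>"
  proof (intro exI[of _ \<delta>] conjI ballI impI \<delta>(1))
    fix x' assume x': "x' \<in> {a..b}" "dist x' x < \<delta>"
    show "dist (g x') (g x) < \<epsilon>"
      using *[of x x'] *[of x' x] x x' by (cases "x \<le> x'") (auto simp: dist_real_def abs_minus_commute)
  qed
qed


text \<open>Half-open cells partition the half-open rectangle exactly, which gives an instance of
  \<open>refining_partitions\<close>. Its density has the right integrals over grid rectangles;
  general corners are reached by continuity of the increment on one side and dominated convergence
  on the other.\<close>

lemma rect_density_half_open: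
  assumes ab: "a < b" "c < d" and ac: "rect_abs_cont a b c d f"
  obtains h :: "real \<times> real \<Rightarrow> real" where "integrable lborel h"
    "\<And>x y. \<lbrakk>x \<in> {a..b}; y \<in> {c..d}\<rbrakk> \<Longrightarrow>
      (LINT p:{a..<x} \<times> {c..<y}|lborel. h p) = f (x, y) - f (x, c) - f (a, y) + f (a, c)"
proof -
  define X Y where "X n i = a + (b - a) * real i / 2 ^ n" and "Y n i = c + (d - c) * real i / 2 ^ n"
    for n i :: nat
  have mono: "strict_mono (X n)" "strict_mono (Y n)" for n
    using ab by (auto simp: strict_mono_def X_def Y_def divide_strict_right_mono)
  have mono': "mono (X n)" "mono (Y n)" for n
    using mono by (auto intro: strict_mono_mono)
  have ends: "X n 0 = a" "X n (2 ^ n) = b" "Y n 0 = c" "Y n (2 ^ n) = d" for n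
    by (simp_all add: X_def Y_def)
  \<comment> \<open>\<open>k\<close> further bisections multiply the index of a grid point by
    \<open>2 ^ k\<close>.\<close>
  have XY_refine: "X n i = X (n + k) (i * 2 ^ k)" "Y n i = Y (n + k) (i * 2 ^ k)" for n i k
    by (simp_all add: X_def Y_def power_add)
  have XY_in: "X n i \<in> {a..b}" "Y n i \<in> {c..d}" if "i \<le> 2 ^ n" for n i
    using monoD[OF mono'(1)[of n], of 0 i] monoD[OF mono'(1)[of n], OF that]
      monoD[OF mono'(2)[of n], of 0 i] monoD[OF mono'(2)[of n], OF that] by (auto simp: ends)
  define I :: "nat \<Rightarrow> (nat \<times> nat) set" where "I n = {0..<2 ^ n} \<times> {0..<2 ^ n}" for n
  define Q where "Q n = (\<lambda>(i, j). {X n i..<X n (Suc i)} \<times> {Y n j..<Y n (Suc j)})" for n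
  define \<nu> where "\<nu> n = (\<lambda>(i, j). f (X n (Suc i), Y n (Suc j)) - f (X n i, Y n (Suc j))
    - f (X n (Suc i), Y n j) + f (X n i, Y n j))" for n
  define \<Omega> where "\<Omega> = {a..<b} \<times> {c..<d}"
  define M where "M = restrict_space lborel \<Omega>"
  have prodM: "measure lborel ({p..<q} \<times> {r..<s}) = (q - p) * (s - r)"
    "emeasure lborel ({p..<q} \<times> {r..<s}) \<noteq> \<infinity>" if "p \<le> q" "r \<le> s" for p q r s :: real
  proof -
    have "emeasure lborel ({p..<q} \<times> {r..<s}) = ennreal ((q - p) * (s - r))"
      using that by (subst lborel_prod[symmetric])
        (simp add: lborel.emeasure_pair_measure_Times ennreal_mult)
    then show "measure lborel ({p..<q} \<times> {r..<s}) = (q - p) * (s - r)"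
      "emeasure lborel ({p..<q} \<times> {r..<s}) \<noteq> \<infinity>" using that by (auto simp: measure_def)
  qed
  have \<Omega>[measurable]: "\<Omega> \<in> sets lborel" by (simp add: \<Omega>_def borel_Times)
  have block: "(\<Union>j\<in>{p..<q} \<times> {r..<s}. Q n j) = {X n p..<X n q} \<times> {Y n r..<Y n s}"
    if "p \<le> q" "r \<le> s" for n p q r s
    by (auto simp: Q_def atLeastLessThan_UN_steps[OF mono'(1) that(1)] atLeastLessThan_UN_steps[OF mono'(2) that(2)])
  have block_sum: "(\<Sum>j\<in>{p..<q} \<times> {r..<s}. \<nu> n j) = f (X n q, Y n s) - f (X n p, Y n s)
      - f (X n q, Y n r) + f (X n p, Y n r)" if "p \<le> q" "r \<le> s" for n p q r s
    using sum_increments[OF that, of "\<lambda>i j. f (X n i, Y n j)"] by (simp add: \<nu>_def)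
  have cells: "(\<Union>i\<in>I n. Q n i) = \<Omega>" for n
    unfolding I_def by (subst block) (auto simp: ends \<Omega>_def)
  have Q_sub: "Q n i \<subseteq> \<Omega>" if "i \<in> I n" for n i using cells[of n] that by blast
  have Q_sets: "Q n i \<in> sets lborel" for n i by (auto simp: Q_def borel_Times split: prod.split)
  have disjQ: "disjoint_family_on (Q n) S" for n S
  proof -
    have *: "i = i'" if "x \<in> {t i..<t (Suc i)}" "x \<in> {t i'..<t (Suc i')}" "strict_mono t" for t :: "nat \<Rightarrow> real" and x i i'
    proof -
      have "t i < t (Suc i')" "t i' < t (Suc i)" using that by auto
      then show ?thesis using that(3) by (simp add: strict_mono_less)
    qed
    show ?thesis
      unfolding disjoint_family_on_def Q_def
      using *[OF _ _ mono(1)] *[OF _ _ mono(2)] by fast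
  qed
  have measQ: "measure lborel (Q n j) = ((b - a) / 2 ^ n) * ((d - c) / 2 ^ n)" for n j
  proof (cases j)
    case (Pair i k)
    have "X n (Suc i) - X n i = (b - a) / 2 ^ n" "Y n (Suc k) - Y n k = (d - c) / 2 ^ n"
      by (simp_all add: X_def Y_def field_simps)
    then show ?thesis
      using prodM(1)[of "X n i" "X n (Suc i)" "Y n k" "Y n (Suc k)"] mono'
      by (simp add: Pair Q_def incseq_SucD)
  qed
  have measM: "measure M (Q n i) = measure lborel (Q n i)" if "i \<in> I n" for n i
    unfolding M_def using Q_sub[OF that] \<Omega> by (intro measure_restrict_space) auto
  interpret finite_measure M
  proof (rule finite_measureI)
    show "emeasure M (space M) \<noteq> \<infinity>"
      unfolding M_def using prodM(2)[of a b c d] ab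
      by (subst emeasure_restrict_space) (auto simp: space_restrict_space \<Omega>_def borel_Times)
  qed
  interpret refining_partitions M I Q \<nu>
  proof
    fix n
    show "finite (I n)" by (simp add: I_def)
    show "disjoint_family_on (Q n) (I n)" by (rule disjQ)
    show "(\<Union>i\<in>I n. Q n i) = space M" by (simp add: M_def cells space_restrict_space)
    fix i assume i: "i \<in> I n"
    show "Q n i \<in> sets M"
      unfolding M_def using Q_sub[OF i] Q_sets \<Omega> by (subst sets_restrict_space_iff) auto
    show "0 < measure M (Q n i)" using ab by (simp add: measM[OF i] measQ)
    fix m assume "n \<le> m"
    then obtain k where m: "m = n + k" using le_Suc_ex by blast
    obtain p q where pq: "i = (p, q)" "p < 2 ^ n" "q < 2 ^ n" using i by (auto simp: I_def)
    \<comment> \<open>The cells of level \<open>n + k\<close> inside the cell \<open>(p, q)\<close>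
      of level \<open>n\<close>.\<close>
    let ?J = "{p * 2 ^ k..<Suc p * 2 ^ k} \<times> {q * 2 ^ k..<Suc q * 2 ^ k}"
    show "\<exists>J\<subseteq>I m. Q n i = (\<Union>j\<in>J. Q m j) \<and> \<nu> n i = (\<Sum>j\<in>J. \<nu> m j)"
    proof (intro exI[of _ ?J] conjI)
      have "Suc p * 2 ^ k \<le> 2 ^ n * 2 ^ k" "Suc q * 2 ^ k \<le> 2 ^ n * 2 ^ k"
        using pq by (intro mult_right_mono; simp)+
      then show "?J \<subseteq> I m" by (auto simp: I_def m power_add)
      show "Q n i = (\<Union>j\<in>?J. Q m j)"
        by (subst block) (auto simp: Q_def pq m XY_refine[of n _ k])
      show "\<nu> n i = (\<Sum>j\<in>?J. \<nu> m j)"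
        by (subst block_sum) (auto simp: \<nu>_def pq m XY_refine[of n _ k])
    qed
  next
    fix \<delta> :: real assume "0 < \<delta>"
    have "(\<lambda>n. ((b - a) * (d - c)) * (1 / 4) ^ n) \<longlonglongrightarrow> ((b - a) * (d - c)) * 0"
      by (intro tendsto_intros LIMSEQ_power_zero) simp
    then have "\<forall>\<^sub>F n in sequentially. ((b - a) * (d - c)) * (1 / 4) ^ n < \<delta>"
      using \<open>0 < \<delta>\<close> by (intro order_tendstoD) auto
    then obtain n where n: "((b - a) * (d - c)) * (1 / 4) ^ n < \<delta>"
      by (auto simp: eventually_sequentially)
    have "((b - a) / 2 ^ n) * ((d - c) / 2 ^ n) = ((b - a) * (d - c)) * (1 / 4) ^ n"
      by (simp add: power_divide power_mult_distrib[of 2 2, symmetric])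
    then show "\<exists>n. \<forall>i\<in>I n. measure M (Q n i) < \<delta>"
      using n by (intro exI[of _ n]) (simp add: measM measQ)
  next
    fix \<epsilon> :: real assume "0 < \<epsilon>"
    then obtain \<delta> where \<delta>: "\<delta> > 0" "\<And>D. \<lbrakk>D division_of \<Union>D; \<Union>D \<subseteq> {a..b} \<times> {c..d}; (\<Sum>K\<in>D. measure lborel K) < \<delta>\<rbrakk> \<Longrightarrow>
      (\<Sum>K\<in>D. \<bar>rect_increment f K\<bar>) < \<epsilon>"
      using ac unfolding rect_abs_cont_def by metis
    have "(\<Sum>j\<in>J. \<bar>\<nu> n j\<bar>) < \<epsilon>" if J: "J \<subseteq> I n" and lt: "(\<Sum>j\<in>J. measure M (Q n j)) < \<delta>" for n J
    proof -
      \<comment> \<open>The closures of the cells: absolute continuity is stated for divisions into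
        compact boxes, so the half-open cells have to be closed up. Measure and increment are
        unchanged.\<close>
      define K where "K = (\<lambda>(i, j). cbox (X n i, Y n j) (X n (Suc i), Y n (Suc j)))"
      have le: "X n i \<le> X n (Suc i)" "Y n i \<le> Y n (Suc i)" for i
        using mono' by (auto simp: incseq_SucD)
      have inj: "inj_on K J"
        using le mono by (auto simp: inj_on_def K_def cbox_Pair_eq times_eq_iff strict_mono_eq)
      have "finite J" using J by (rule finite_subset) (simp add: I_def)
      \<comment> \<open>The interior of a closed box lies in its half-open cell, and these cells are
        disjoint.\<close>
      have intK: "interior (K i) \<inter> interior (K j) = {}" if "K i \<noteq> K j" for i j
      proof -
        have "i \<noteq> j" using that by auto
        have "interior (K k) \<subseteq> Q n k" for k
          by (auto simp: K_def Q_def cbox_Pair_eq interior_Times split: prod.split)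
        then show ?thesis using disjQ[of n UNIV] \<open>i \<noteq> j\<close> unfolding disjoint_family_on_def by blast
      qed
      have "K ` J division_of \<Union>(K ` J)"
      proof (rule division_ofI)
        show "finite (K ` J)" using \<open>finite J\<close> by simp
        fix k assume "k \<in> K ` J"
        then obtain i j where k: "k = cbox (X n i, Y n j) (X n (Suc i), Y n (Suc j))" by (auto simp: K_def)
        then show "\<exists>a b. k = cbox a b" by blast
        show "k \<noteq> {}" using le by (simp add: k cbox_Pair_eq)
        show "k \<subseteq> \<Union>(K ` J)" using \<open>k \<in> K ` J\<close> by blast
        fix k' assume "k' \<in> K ` J" "k \<noteq> k'"
        then show "interior k \<inter> interior k' = {}" using intK \<open>k \<in> K ` J\<close> by blast
      qed (rule refl)
      moreover have "\<Union>(K ` J) \<subseteq> {a..b} \<times> {c..d}"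
      proof -
        have "K j \<subseteq> {a..b} \<times> {c..d}" if jJ: "j \<in> J" for j
        proof -
          obtain p q where "j = (p, q)" "p < 2 ^ n" "q < 2 ^ n" using jJ J by (auto simp: I_def)
          then show ?thesis
            using XY_in[of p n] XY_in[of "Suc p" n] XY_in[of q n] XY_in[of "Suc q" n]
            by (auto simp: K_def cbox_Pair_eq)
        qed
        then show ?thesis by blast
      qed
      moreover have "(\<Sum>k\<in>K ` J. measure lborel k) < \<delta>"
      proof -
        have "measure lborel (K j) = measure M (Q n j)" if "j \<in> J" for j
        proof -
          have "j \<in> I n" using that J by blast
          from measM[OF this] show ?thesis
            using le by (cases j) (simp add: K_def Q_def measure_cbox_real_pair prodM)
        qed
        then show ?thesis using lt by (simp add: sum.reindex[OF inj])
      qed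
      ultimately have "(\<Sum>k\<in>K ` J. \<bar>rect_increment f k\<bar>) < \<epsilon>" by (rule \<delta>(2))
      moreover have "rect_increment f (K j) = \<nu> n j" for j
        using le by (cases j) (simp add: K_def \<nu>_def rect_increment_cbox)
      ultimately show ?thesis by (simp add: sum.reindex[OF inj])
    qed
    with \<delta>(1) show "\<exists>\<delta>>0. \<forall>n. \<forall>J\<subseteq>I n. (\<Sum>j\<in>J. measure M (Q n j)) < \<delta> \<longrightarrow> (\<Sum>j\<in>J. \<bar>\<nu> n j\<bar>) < \<epsilon>"
      by blast
  qed
  obtain h0 where h0: "integrable M h0" "\<And>n i. i \<in> I n \<Longrightarrow> (LINT x:Q n i|M. h0 x) = \<nu> n i"
    using density_exists by blast
  define h where "h p = indicator \<Omega> p * h0 p" for p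
  have h: "integrable lborel h"
    using h0(1) unfolding M_def h_def using \<Omega> by (subst (asm) integrable_restrict_space) auto
  have "(LINT p:Q n i|lborel. h p) = \<nu> n i" if i: "i \<in> I n" for n i
  proof -
    have "(LINT p:Q n i|lborel. h p) = (LINT p|lborel. indicator \<Omega> p *\<^sub>R (indicator (Q n i) p *\<^sub>R h0 p))"
      by (simp add: set_lebesgue_integral_def h_def mult.left_commute)
    also have "\<dots> = (LINT p:Q n i|M. h0 p)"
      unfolding M_def set_lebesgue_integral_def using \<Omega> by (subst integral_restrict_space) auto
    finally show ?thesis using h0(2)[OF i] by simp
  qed
  note cell = this
  have grid: "(LINT p:{a..<X n i} \<times> {c..<Y n j}|lborel. h p)
      = f (X n i, Y n j) - f (X n i, c) - f (a, Y n j) + f (a, c)" if ij: "i \<le> 2 ^ n" "j \<le> 2 ^ n" for n i j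
  proof -
    let ?J = "{0..<i} \<times> {0..<j}"
    have sub: "?J \<subseteq> I n" using ij by (auto simp: I_def)
    have "(LINT p:{a..<X n i} \<times> {c..<Y n j}|lborel. h p) = (LINT p:(\<Union>k\<in>?J. Q n k)|lborel. h p)"
      by (subst block) (simp_all add: ends)
    also have "\<dots> = (\<Sum>k\<in>?J. LINT p:Q n k|lborel. h p)"
    proof (rule set_integral_finite_Union)
      show "disjoint_family_on (Q n) ?J" by (rule disjQ)
      show "set_integrable lborel (Q n k) h" for k
        unfolding set_integrable_def by (intro integrable_mult_indicator Q_sets h)
    qed (use Q_sets in auto)
    also have "\<dots> = (\<Sum>k\<in>?J. \<nu> n k)" using sub by (intro sum.cong refl cell) blast
    also have "\<dots> = f (X n i, Y n j) - f (X n i, c) - f (a, Y n j) + f (a, c)"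
      by (subst block_sum) (simp_all add: ends)
    finally show ?thesis .
  qed
  have "(LINT p:{a..<x} \<times> {c..<y}|lborel. h p) = f (x, y) - f (x, c) - f (a, y) + f (a, c)"
    if xy: "x \<in> {a..b}" "y \<in> {c..d}" for x y
  proof -
    \<comment> \<open>Indices of the last grid points not exceeding \<open>x\<close> and
      \<open>y\<close>. Approximation from below fits half-open rectangles: a point lies in the
      limit rectangle exactly if it eventually lies in the approximating ones, so the indicators
      converge everywhere.\<close>
    define i j where "i n = nat \<lfloor>(x - a) / (b - a) * 2 ^ n\<rfloor>" and "j n = nat \<lfloor>(y - c) / (d - c) * 2 ^ n\<rfloor>" for n :: nat
    have dyadic: "nat \<lfloor>t * 2 ^ n\<rfloor> \<le> 2 ^ n \<and> real (nat \<lfloor>t * 2 ^ n\<rfloor>) / 2 ^ n \<le> t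
      \<and> t - (1 / 2) ^ n \<le> real (nat \<lfloor>t * 2 ^ n\<rfloor>) / 2 ^ n" if "0 \<le> t" "t \<le> 1" for t :: real and n :: nat
    proof -
      have 0: "0 \<le> t * 2 ^ n" using that by simp
      have "\<lfloor>t * 2 ^ n\<rfloor> \<le> \<lfloor>(2::real) ^ n\<rfloor>" using that by (intro floor_mono) simp
      then have 1: "\<lfloor>t * 2 ^ n\<rfloor> \<le> 2 ^ n" by (metis floor_of_int of_int_numeral of_int_power)
      have 2: "real (nat \<lfloor>t * 2 ^ n\<rfloor>) = of_int \<lfloor>t * 2 ^ n\<rfloor>" using 0 by simp
      have 3: "of_int \<lfloor>t * 2 ^ n\<rfloor> \<le> t * 2 ^ n" "t * 2 ^ n - 1 \<le> of_int \<lfloor>t * 2 ^ n\<rfloor>" by linarith+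
      have "nat \<lfloor>t * 2 ^ n\<rfloor> \<le> 2 ^ n" using 1 by (simp add: nat_le_iff)
      moreover have "of_int \<lfloor>t * 2 ^ n\<rfloor> / 2 ^ n \<le> t" using 3(1) by (simp add: pos_divide_le_eq)
      moreover have "(t * 2 ^ n - 1) / 2 ^ n \<le> of_int \<lfloor>t * 2 ^ n\<rfloor> / 2 ^ n"
        using 3(2) by (intro divide_right_mono) auto
      ultimately show ?thesis unfolding 2 by (simp add: diff_divide_distrib power_one_over)
    qed
    have ratio: "0 \<le> (x - a) / (b - a)" "(x - a) / (b - a) \<le> 1" "0 \<le> (y - c) / (d - c)" "(y - c) / (d - c) \<le> 1"
      using xy ab by auto
    have lim0: "(\<lambda>n. real (nat \<lfloor>t * 2 ^ n\<rfloor>) / 2 ^ n) \<longlonglongrightarrow> t" if "0 \<le> t" "t \<le> 1" for t :: real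
    proof (rule tendsto_sandwich[where f = "\<lambda>n. t - (1 / 2) ^ n" and h = "\<lambda>_. t"])
      have "(\<lambda>n. t - (1 / 2) ^ n) \<longlonglongrightarrow> t - 0"
        by (intro tendsto_intros LIMSEQ_power_zero) simp
      then show "(\<lambda>n. t - (1 / 2) ^ n) \<longlonglongrightarrow> t" by simp
    qed (use dyadic[OF that] in \<open>auto intro!: always_eventually tendsto_const\<close>)
    have lim: "(\<lambda>n. X n (i n)) \<longlonglongrightarrow> x" "(\<lambda>n. Y n (j n)) \<longlonglongrightarrow> y"
    proof -
      have "(\<lambda>n. a + (b - a) * (real (i n) / 2 ^ n)) \<longlonglongrightarrow> a + (b - a) * ((x - a) / (b - a))"
        unfolding i_def by (intro tendsto_intros lim0 ratio)
      then show "(\<lambda>n. X n (i n)) \<longlonglongrightarrow> x" using ab by (simp add: X_def)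
      have "(\<lambda>n. c + (d - c) * (real (j n) / 2 ^ n)) \<longlonglongrightarrow> c + (d - c) * ((y - c) / (d - c))"
        unfolding j_def by (intro tendsto_intros lim0 ratio)
      then show "(\<lambda>n. Y n (j n)) \<longlonglongrightarrow> y" using ab by (simp add: Y_def)
    qed
    have le: "X n (i n) \<le> x" "Y n (j n) \<le> y" "i n \<le> 2 ^ n" "j n \<le> 2 ^ n" for n
    proof -
      have "(b - a) * (real (i n) / 2 ^ n) \<le> (b - a) * ((x - a) / (b - a))"
        unfolding i_def using dyadic[OF ratio(1,2), of n] ab by (intro mult_left_mono) auto
      then show "X n (i n) \<le> x" using ab by (simp add: X_def)
      have "(d - c) * (real (j n) / 2 ^ n) \<le> (d - c) * ((y - c) / (d - c))"
        unfolding j_def using dyadic[OF ratio(3,4), of n] ab by (intro mult_left_mono) auto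
      then show "Y n (j n) \<le> y" using ab by (simp add: Y_def)
      show "i n \<le> 2 ^ n" "j n \<le> 2 ^ n"
        unfolding i_def j_def using dyadic[OF ratio(1,2), of n] dyadic[OF ratio(3,4), of n] by auto
    qed
    have int_lim: "(\<lambda>n. LINT p:{a..<X n (i n)} \<times> {c..<Y n (j n)}|lborel. h p) \<longlonglongrightarrow> (LINT p:{a..<x} \<times> {c..<y}|lborel. h p)"
      unfolding set_lebesgue_integral_def
    proof (rule integral_dominated_convergence[where w = "\<lambda>p. norm (h p)"])
      show "AE p in lborel. (\<lambda>n. indicator ({a..<X n (i n)} \<times> {c..<Y n (j n)}) p *\<^sub>R h p)
          \<longlonglongrightarrow> indicator ({a..<x} \<times> {c..<y}) p *\<^sub>R h p"
      proof (rule AE_I2)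
        fix p :: "real \<times> real"
        have "\<forall>\<^sub>F n in sequentially. indicator ({a..<X n (i n)} \<times> {c..<Y n (j n)}) p
            = (indicator ({a..<x} \<times> {c..<y}) p :: real)"
        proof (cases "fst p < x \<and> snd p < y")
          case True
          then have "\<forall>\<^sub>F n in sequentially. fst p < X n (i n)" "\<forall>\<^sub>F n in sequentially. snd p < Y n (j n)"
            using order_tendstoD(1)[OF lim(1)] order_tendstoD(1)[OF lim(2)] by auto
          then show ?thesis
          proof eventually_elim
            case (elim n)
            with True show ?case by (cases p) (auto simp: indicator_def)
          qed
        next
          case False
          then have "\<not> (fst p < X n (i n) \<and> snd p < Y n (j n))" for n
            using le[of n] by linarith
          with False show ?thesis
            by (cases p) (auto simp: indicator_def)
        qed
        then show "(\<lambda>n. indicator ({a..<X n (i n)} \<times> {c..<Y n (j n)}) p *\<^sub>R h p)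
          \<longlonglongrightarrow> indicator ({a..<x} \<times> {c..<y}) p *\<^sub>R h p"
          by (intro tendsto_intros tendsto_eventually)
      qed
      show "integrable lborel (\<lambda>p. norm (h p))" using h by simp
      have [measurable]: "h \<in> borel_measurable lborel" using h by simp
      show "(\<lambda>p. indicator ({a..<x} \<times> {c..<y}) p *\<^sub>R h p) \<in> borel_measurable lborel"
        "(\<lambda>p. indicator ({a..<X n (i n)} \<times> {c..<Y n (j n)}) p *\<^sub>R h p) \<in> borel_measurable lborel" for n
        by (intro borel_measurable_scaleR borel_measurable_indicator; simp add: borel_Times)+
    qed (auto simp: indicator_def)
    let ?F = "\<lambda>(x, y). f (x, y) - f (x, c) - f (a, y) + f (a, c)"
    have "(\<lambda>n. ?F (X n (i n), Y n (j n))) \<longlonglongrightarrow> ?F (x, y)"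
    proof (rule continuous_on_tendsto_compose[OF continuous_on_increment[OF ac]])
      show "(\<lambda>n. (X n (i n), Y n (j n))) \<longlonglongrightarrow> (x, y)" by (intro tendsto_Pair lim)
      show "\<forall>\<^sub>F n in sequentially. (X n (i n), Y n (j n)) \<in> {a..b} \<times> {c..d}"
        using XY_in le by auto
    qed (use xy in auto)
    then have "(\<lambda>n. LINT p:{a..<X n (i n)} \<times> {c..<Y n (j n)}|lborel. h p) \<longlonglongrightarrow> ?F (x, y)"
      using grid[OF le(3,4)] by simp
    from LIMSEQ_unique[OF int_lim this] show ?thesis by simp
  qed
  with h show ?thesis using that by blast
qed

section \<open>Differentiation and integration by parts\<close>

text \<open>Lets a function known only up to a null set, such as the mixed derivative, be exchanged
  for a Borel function under the integral.\<close>

lemma integral_lebesgue_eq_lborel: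
  fixes f g :: "'a::euclidean_space \<Rightarrow> real"
  assumes g: "g \<in> borel_measurable borel" and eq: "AE x in lborel. f x = g x"
  shows "integral\<^sup>L lebesgue f = integral\<^sup>L lborel g"
proof -
  have eq': "AE x in lebesgue. f x = g x" using eq by (rule AE_completion)
  have g': "g \<in> borel_measurable lebesgue" using g by (intro measurable_completion) simp
  \<comment> \<open>Completeness of \<open>lebesgue\<close>: preimages under \<open>f\<close> and
    \<open>g\<close> differ by subsets of a null set.\<close>
  have "f \<in> borel_measurable lebesgue"
  proof (rule measurableI)
    fix A :: "real set" assume "A \<in> sets borel"
    then have "g -` A \<inter> space lebesgue \<in> sets lebesgue" using g' by (rule measurable_sets[rotated])
    then show "f -` A \<inter> space lebesgue \<in> sets lebesgue"
      by (rule completion.in_sets_AE[rotated]) (use eq' in \<open>auto elim: eventually_mono\<close>)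
  qed simp
  then have "integral\<^sup>L lebesgue f = integral\<^sup>L lebesgue g"
    using g' eq' by (intro integral_cong_AE)
  also have "\<dots> = integral\<^sup>L lborel g" using g by (intro integral_completion) simp
  finally show ?thesis .
qed

text \<open>Lebesgue differentiation for cubes that have the point as lower corner, hence one-sided
  on the line.\<close>

lemma AE_right_average:
  fixes k :: "real \<Rightarrow> real"
  assumes k: "integrable lborel k"
  shows "AE x in lborel. \<forall>e>0. \<exists>d>0. \<forall>h. 0 < h \<and> h < d \<longrightarrow> \<bar>(LINT s:{x..x + h}|lborel. k s) / h - k x\<bar> < e"
proof -
  have si: "set_integrable lborel {u..v} k" for u v
    using k unfolding set_integrable_def by (intro integrable_mult_indicator) auto
  have "k integrable_on cbox u v" for u v
    using set_borel_integral_eq_integral(1)[OF si] by (simp add: cbox_interval)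
  then obtain N where N: "negligible N" "\<And>x e. \<lbrakk>x \<notin> N; 0 < e\<rbrakk> \<Longrightarrow>
      \<exists>d>0. \<forall>h. 0 < h \<and> h < d \<longrightarrow> norm (integral (cbox x (x + h *\<^sub>R One)) k /\<^sub>R h ^ DIM(real) - k x) < e"
    using integrable_ccontinuous_explicit by blast
  have "AE x in lebesgue. x \<notin> N" using N(1) by (simp add: negligible_iff_null_sets AE_not_in)
  then have "AE x in lborel. x \<notin> N" by (simp add: AE_completion_iff)
  then show ?thesis
  proof eventually_elim
    case (elim x)
    then show ?case
      using N(2)[of x] set_borel_integral_eq_integral(2)[OF si] by (simp add: cbox_interval divide_inverse mult.commute)
  qed
qed

text \<open>\<open>P\<close> may fail to be measurable; the complement of a Borel null set
  containing its exceptions is transported instead.\<close>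

lemma AE_lborel_affine:
  fixes P :: "real \<Rightarrow> bool"
  assumes "c \<noteq> 0" "AE x in lborel. P x"
  shows "AE x in lborel. P (t + c * x)"
proof -
  obtain N where N: "N \<in> null_sets lborel" "{x. \<not> P x} \<subseteq> N"
    using assms(2) by (auto simp: eventually_ae_filter)
  then have [measurable]: "N \<in> sets borel" by auto
  have "AE x in lborel. x \<notin> N" using N(1) by (rule AE_not_in)
  then have "AE x in lborel. t + c * x \<notin> N" by (intro AE_borel_affine[OF assms(1)]) measurable
  then show ?thesis using N(2) by (auto elim!: eventually_mono)
qed

text \<open>The derivative depends only on averages near \<open>x\<close>, so the exceptional null
  set can be chosen independently of the lower limit \<open>a\<close>.\<close>

lemma AE_has_real_derivative_integral:
  fixes k :: "real \<Rightarrow> real"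
  assumes k: "integrable lborel k"
  shows "AE x in lborel. \<forall>a<x. ((\<lambda>u. LINT s:{a..u}|lborel. k s) has_real_derivative k x) (at x)"
proof -
  have si: "set_integrable lborel {u..v} k" for u v
    using k unfolding set_integrable_def by (intro integrable_mult_indicator) auto
  \<comment> \<open>Left averages of \<open>k\<close> are right averages of its reflection.\<close>
  have "integrable lborel (\<lambda>x. k (- x))"
    using lborel_integrable_real_affine[OF k, of "-1" 0] by simp
  from AE_lborel_affine[OF _ AE_right_average[OF this], of "-1" 0]
  have "AE x in lborel. \<forall>e>0. \<exists>d>0. \<forall>h. 0 < h \<and> h < d \<longrightarrow> \<bar>(LINT s:{- x..- x + h}|lborel. k (- s)) / h - k x\<bar> < e"
    by simp
  moreover have refl: "(LINT s:{- x..- x + h}|lborel. k (- s)) = (LINT s:{x - h..x}|lborel. k s)" for x h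
  proof -
    have "(LINT s:{x - h..x}|lborel. k s) = (LINT s|lborel. indicator {x - h..x} (- s) * k (- s))"
      unfolding set_lebesgue_integral_def
      by (subst lborel_integral_real_affine[where c = "-1" and t = 0]) auto
    also have "\<dots> = (LINT s:{- x..- x + h}|lborel. k (- s))"
      unfolding set_lebesgue_integral_def
      by (intro Bochner_Integration.integral_cong refl) (auto simp: indicator_def)
    finally show ?thesis ..
  qed
  ultimately have left: "AE x in lborel. \<forall>e>0. \<exists>d>0. \<forall>h. 0 < h \<and> h < d \<longrightarrow> \<bar>(LINT s:{x - h..x}|lborel. k s) / h - k x\<bar> < e"
    by simp
  have split: "(LINT s:{a..v}|lborel. k s) = (LINT s:{a..u}|lborel. k s) + (LINT s:{u..v}|lborel. k s)"
    if "a \<le> u" "u \<le> v" for a u v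
  proof -
    have "k integrable_on {a..v}" using si by (rule set_borel_integral_eq_integral)
    from Henstock_Kurzweil_Integration.integral_combine[OF that this] show ?thesis
      by (simp add: set_borel_integral_eq_integral(2)[OF si])
  qed
  show ?thesis
    using left AE_right_average[OF k]
  proof eventually_elim
    case (elim x)
    show ?case
    proof (intro allI impI)
      fix a assume a: "a < x"
      show "((\<lambda>u. LINT s:{a..u}|lborel. k s) has_real_derivative k x) (at x)"
        unfolding has_field_derivative_def has_derivative_at_alt
      proof (intro conjI allI impI)
        fix e :: real assume e: "0 < e"
        obtain d1 where d1: "d1 > 0" "\<And>h. \<lbrakk>0 < h; h < d1\<rbrakk> \<Longrightarrow> \<bar>(LINT s:{x - h..x}|lborel. k s) / h - k x\<bar> < e"
          using elim(1) e by blast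
        obtain d2 where d2: "d2 > 0" "\<And>h. \<lbrakk>0 < h; h < d2\<rbrakk> \<Longrightarrow> \<bar>(LINT s:{x..x + h}|lborel. k s) / h - k x\<bar> < e"
          using elim(2) e by blast
        have scale: "\<bar>J - k x * h\<bar> \<le> e * h" if "\<bar>J / h - k x\<bar> < e" "0 < h" for J h
        proof -
          have "\<bar>J - k x * h\<bar> = \<bar>(J / h - k x) * h\<bar>" using that by (simp add: left_diff_distrib)
          also have "\<dots> = \<bar>J / h - k x\<bar> * h" using that by (simp add: abs_mult)
          also have "\<dots> \<le> e * h" using that by (intro mult_right_mono) auto
          finally show ?thesis .
        qed
        show "\<exists>d>0. \<forall>y. norm (y - x) < d \<longrightarrow>
          norm ((LINT s:{a..y}|lborel. k s) - (LINT s:{a..x}|lborel. k s) - k x * (y - x)) \<le> e * norm (y - x)"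
        \<comment> \<open>The bound \<open>x - a\<close> keeps \<open>y\<close> to the right of
          \<open>a\<close>, where the integrals can be split.\<close>
        proof (intro exI[of _ "min (min d1 d2) (x - a)"] conjI allI impI)
          show "0 < min (min d1 d2) (x - a)" using d1(1) d2(1) a by simp
          fix y assume y: "norm (y - x) < min (min d1 d2) (x - a)"
          consider "y = x" | "x < y" | "y < x" by linarith
          then show "norm ((LINT s:{a..y}|lborel. k s) - (LINT s:{a..x}|lborel. k s) - k x * (y - x)) \<le> e * norm (y - x)"
          proof cases
            case 2
            then have "(LINT s:{a..y}|lborel. k s) - (LINT s:{a..x}|lborel. k s) = (LINT s:{x..x + (y - x)}|lborel. k s)"
              using split[of a x y] a by simp
            then show ?thesis using scale[OF d2(2)[of "y - x"]] 2 y by simp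
          next
            case 3
            then have "(LINT s:{a..x}|lborel. k s) - (LINT s:{a..y}|lborel. k s) = (LINT s:{x - (x - y)..x}|lborel. k s)"
              using split[of a y x] y by simp
            moreover have "\<bar>(LINT s:{x - (x - y)..x}|lborel. k s) - k x * (x - y)\<bar> \<le> e * (x - y)"
              using 3 y by (intro scale d1(2)) auto
            moreover have "k x * (y - x) = - (k x * (x - y))" by (simp add: algebra_simps)
            moreover have "norm (y - x) = x - y" using 3 by simp
            ultimately show ?thesis unfolding real_norm_def by (metis (no_types, opaque_lifting) abs_minus_commute diff_minus_eq_add minus_diff_eq uminus_add_conv_diff add.commute)
          qed simp
        qed
      qed (rule bounded_linear_mult_right)
    qed
  qed
qed

text \<open>The affine weight is written from its value \<open>r\<close> at \<open>b\<close> and its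
  slope \<open>m\<close>. Against the antiderivative of \<open>k\<close> vanishing at
  \<open>a\<close>, the only boundary term is then \<open>r\<close> times the full integral.\<close>

lemma integral_by_parts_linear:
  fixes k :: "real \<Rightarrow> real"
  assumes k: "integrable lborel k" and ab: "a \<le> b"
  shows "(LINT x:{a..b}|lborel. (r - m * (b - x)) * k x) =
    r * (LINT x:{a..b}|lborel. k x) - m * (LINT s:{a..b}|lborel. LINT x:{a..s}|lborel. k x)"
proof -
  note [measurable] = borel_measurable_integrable[OF k, simplified]
  have si: "integrable lborel (\<lambda>x. indicator {a..b} x * k x)"
    using integrable_mult_indicator[OF _ k, of "{a..b}"] by simp
  have sb: "integrable lborel (\<lambda>x. indicator {a..b} x * (b - x) * k x)"
  proof (rule Bochner_Integration.integrable_bound)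
    show "integrable lborel (\<lambda>x. (b - a) * k x)" using k by simp
    show "AE x in lborel. norm (indicator {a..b} x * (b - x) * k x) \<le> norm ((b - a) * k x)"
      using ab by (auto simp: abs_mult indicator_def intro!: mult_right_mono)
  qed measurable
  \<comment> \<open>Fubini on the triangle \<open>a \<le> x \<le> s \<le> b\<close>, with \<open>b - x = \<integral>\<^sub>x\<^sup>b ds\<close>\<close>
  define g where "g x s = (if a \<le> x \<and> x \<le> s \<and> s \<le> b then k x else 0)" for x s :: real
  have g1: "g x s = (indicator {a..b} x * k x) * indicator {x..b} s" for x s
    by (auto simp: g_def indicator_def)
  have g2: "g x s = indicator {a..b} s * (indicator {a..s} x * k x)" for x s
    by (auto simp: g_def indicator_def)
  have mg: "case_prod g \<in> borel_measurable (lborel \<Otimes>\<^sub>M lborel)"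
    unfolding g_def by measurable
  have in1: "(LINT s|lborel. g x s) = indicator {a..b} x * (b - x) * k x" for x
    unfolding g1 by (cases "x \<in> {a..b}") (auto simp: mult.commute)
  have int: "integrable (lborel \<Otimes>\<^sub>M lborel) (case_prod g)"
  proof (rule lborel_pair.Fubini_integrable[OF mg])
    have "(LINT s|lborel. norm (g x s)) = norm (indicator {a..b} x * (b - x) * k x)" for x
      unfolding g1 by (cases "x \<in> {a..b}") (auto simp: abs_mult mult.commute)
    then show "integrable lborel (\<lambda>x. LINT s|lborel. norm (case (x, s) of (x, s) \<Rightarrow> g x s))"
      using sb by simp
    show "AE x in lborel. integrable lborel (\<lambda>s. case (x, s) of (x, s) \<Rightarrow> g x s)"
      unfolding prod.case g1 by (intro AE_I2 integrable_mult_right integrable_real_indicator)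
        (auto simp: emeasure_lborel_Icc_eq)
  qed
  have "(LINT x|lborel. indicator {a..b} x * (b - x) * k x) = (LINT x|lborel. LINT s|lborel. g x s)"
    by (simp add: in1)
  also have "\<dots> = (LINT s|lborel. LINT x|lborel. g x s)"
    by (rule lborel_pair.Fubini_integral[OF int, symmetric])
  also have "\<dots> = (LINT s:{a..b}|lborel. LINT x:{a..s}|lborel. k x)"
    unfolding g2 set_lebesgue_integral_def by simp
  finally have *: "(LINT x|lborel. indicator {a..b} x * (b - x) * k x) = (LINT s:{a..b}|lborel. LINT x:{a..s}|lborel. k x)" .
  have "(LINT x:{a..b}|lborel. (r - m * (b - x)) * k x) =
    (LINT x|lborel. r * (indicator {a..b} x * k x) - m * (indicator {a..b} x * (b - x) * k x))"
    unfolding set_lebesgue_integral_def by (intro Bochner_Integration.integral_cong refl) (simp add: algebra_simps)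
  also have "\<dots> = r * (LINT x|lborel. indicator {a..b} x * k x) - m * (LINT x|lborel. indicator {a..b} x * (b - x) * k x)"
    using si sb by simp
  finally show ?thesis unfolding * by (simp add: set_lebesgue_integral_def)
qed

text \<open>The exceptions of \<open>P\<close> are enclosed in a measurable null set, for which the
  two quantifiers commute. The variable \<open>y\<close> comes first because the differentiation
  argument fixes \<open>y\<close> and then moves along \<open>x\<close>.\<close>

lemma AE_lborel_pair_swap:
  fixes P :: "real \<times> real \<Rightarrow> bool"
  assumes "AE p in lborel. P p"
  shows "AE y in lborel. AE x in lborel. P (x, y)"
proof -
  have "AE p in lborel \<Otimes>\<^sub>M lborel. P p" using assms by (simp only: lborel_prod)
  then obtain N where N: "N \<in> null_sets (lborel \<Otimes>\<^sub>M lborel :: (real \<times> real) measure)" "{p. \<not> P p} \<subseteq> N"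
    by (auto simp: eventually_ae_filter space_pair_measure)
  have m: "{x \<in> space (lborel \<Otimes>\<^sub>M lborel). (fst x, snd x) \<notin> N} \<in> sets (lborel \<Otimes>\<^sub>M lborel)"
  proof -
    have "{x \<in> space (lborel \<Otimes>\<^sub>M lborel). (fst x, snd x) \<notin> N} = space (lborel \<Otimes>\<^sub>M lborel) - N"
      by auto
    also have "\<dots> \<in> sets (lborel \<Otimes>\<^sub>M lborel)"
      using N(1) by (intro sets.compl_sets) (rule null_setsD2)
    finally show ?thesis .
  qed
  have "AE x in lborel. AE y in lborel. (x, y) \<notin> N"
    by (rule lborel_pair.AE_pair[OF AE_not_in[OF N(1)]])
  then have "AE y in lborel. AE x in lborel. (x, y) \<notin> N"
    by (subst (asm) lborel_pair.AE_commute[of "\<lambda>x y. (x, y) \<notin> N", OF m])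
  then show ?thesis
    by eventually_elim (use N(2) in \<open>auto elim!: eventually_mono\<close>)
qed

text \<open>Null sections give a null set of the plane through Tonelli's theorem, hence the
  measurability assumption.\<close>

lemma AE_lborel_pairI:
  fixes P :: "real \<times> real \<Rightarrow> bool"
  assumes "Measurable.pred borel P" "AE y in lborel. AE x in lborel. P (x, y)"
  shows "AE p in lborel. P p"
proof -
  have m: "{x \<in> space (lborel \<Otimes>\<^sub>M lborel). P (fst x, snd x)} \<in> sets (lborel \<Otimes>\<^sub>M lborel)"
    unfolding lborel_prod using assms(1) by (simp add: pred_def)
  have "AE x in lborel. AE y in lborel. P (x, y)"
    using assms(2) by (subst lborel_pair.AE_commute[of "\<lambda>x y. P (x, y)", OF m])
  then have "AE p in lborel \<Otimes>\<^sub>M lborel. P p"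
    by (intro lborel_pair.AE_pair_measure) (use m in auto)
  then show ?thesis by (simp only: lborel_prod)
qed

lemma AE_lborel_pairD:
  fixes P :: "real \<times> real \<Rightarrow> bool"
  assumes "AE p in lborel. P p"
  shows "AE x in lborel. AE y in lborel. P (x, y)"
  by (rule lborel_pair.AE_pair) (simp only: lborel_prod assms)

lemma integrable_pair_bounded:
  fixes h g :: "real \<times> real \<Rightarrow> real"
  assumes h: "integrable lborel h" and g: "g \<in> borel_measurable borel" "\<And>p. \<bar>g p\<bar> \<le> B"
  shows "integrable (lborel \<Otimes>\<^sub>M lborel) (\<lambda>p. g p * h p)"
  unfolding lborel_prod
proof (rule Bochner_Integration.integrable_bound)
  show "integrable lborel (\<lambda>p. B * h p)" using h by simp
  show "(\<lambda>p. g p * h p) \<in> borel_measurable lborel"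
    using borel_measurable_integrable[OF h] g(1) by (intro borel_measurable_times) simp_all
  show "AE p in lborel. norm (g p * h p) \<le> norm (B * h p)"
    using g(2) by (auto simp: abs_mult intro!: mult_right_mono order_trans[OF g(2) abs_ge_self])
qed

text \<open>The inner integral \<open>k\<close> is an integrable function of \<open>x\<close>, so
  the one-variable formula applies to it. Its antiderivative is found by Fubini and the same formula
  in \<open>y\<close>.\<close>

lemma integral_by_parts_bilinear:
  fixes h :: "real \<times> real \<Rightarrow> real"
  assumes h: "integrable lborel h" and ab: "a \<le> b" "c \<le> d"
  defines "G \<equiv> \<lambda>x y. LINT t:{c..y}|lborel. LINT s:{a..x}|lborel. h (s, t)"
  shows "(LINT x:{a..b}|lborel. LINT y:{c..d}|lborel. (r1 - m1 * (b - x)) * ((r2 - m2 * (d - y)) * h (x, y))) =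
    r1 * (r2 * G b d - m2 * (LINT y:{c..d}|lborel. G b y))
    - m1 * (LINT x:{a..b}|lborel. r2 * G x d - m2 * (LINT y:{c..d}|lborel. G x y))"
proof -
  have fst_snd: "fst \<in> borel_measurable (borel :: (real \<times> real) measure)"
    "snd \<in> borel_measurable (borel :: (real \<times> real) measure)"
    by (intro borel_measurable_continuous_onI continuous_intros)+
  define H where "H x t = (LINT s:{a..x}|lborel. h (s, t))" for x t
  define k where "k x = (LINT y:{c..d}|lborel. (r2 - m2 * (d - y)) * h (x, y))" for x
  \<comment> \<open>The weight cut off outside \<open>[c, d]\<close>, hence bounded, so that its
    product with \<open>h\<close> is integrable on the plane.\<close>
  let ?q = "\<lambda>y. indicator {c..d} y * (r2 - m2 * (d - y)) :: real"
  have q: "?q \<in> borel_measurable borel" by measurable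
  have q_le: "\<bar>?q y\<bar> \<le> \<bar>r2\<bar> + \<bar>m2\<bar> * (d - c)" for y
  proof (cases "y \<in> {c..d}")
    case True
    have "\<bar>r2 - m2 * (d - y)\<bar> \<le> \<bar>r2\<bar> + \<bar>m2 * (d - y)\<bar>" by (rule abs_triangle_ineq4)
    also have "\<bar>m2 * (d - y)\<bar> \<le> \<bar>m2\<bar> * (d - c)" using True by (auto simp: abs_mult intro!: mult_left_mono)
    finally show ?thesis using True by simp
  qed (use ab in auto)
  have int: "integrable (lborel \<Otimes>\<^sub>M lborel) (\<lambda>(x, y). (indicator {a..X} x * ?q y) * h (x, y))" for X
  proof -
    have "integrable (lborel \<Otimes>\<^sub>M lborel) (\<lambda>p. (indicator {a..X} (fst p) * ?q (snd p)) * h p)"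
    proof (rule integrable_pair_bounded[OF h])
      show "(\<lambda>p :: real \<times> real. indicator {a..X} (fst p) * ?q (snd p)) \<in> borel_measurable borel"
        by (intro borel_measurable_times measurable_compose[OF fst_snd(2) q] measurable_compose[OF fst_snd(1)]) simp
      show "\<bar>indicator {a..X} (fst p) * ?q (snd p)\<bar> \<le> \<bar>r2\<bar> + \<bar>m2\<bar> * (d - c)" for p :: "real \<times> real"
        using q_le[of "snd p"] ab by (cases "fst p \<in> {a..X}") auto
    qed
    then show ?thesis by (simp add: case_prod_unfold)
  qed
  have int': "integrable (lborel \<Otimes>\<^sub>M lborel) (\<lambda>(x, y). ?q y * h (x, y))"
  proof -
    have "integrable (lborel \<Otimes>\<^sub>M lborel) (\<lambda>p. ?q (snd p) * h p)"
    proof (rule integrable_pair_bounded[OF h])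
      show "(\<lambda>p :: real \<times> real. ?q (snd p)) \<in> borel_measurable borel"
        by (rule measurable_compose[OF fst_snd(2) q])
    qed (rule q_le)
    then show ?thesis by (simp add: case_prod_unfold)
  qed
  have intH: "integrable lborel (H X)" for X
  proof -
    have "integrable (lborel \<Otimes>\<^sub>M lborel) (\<lambda>p. indicator {a..X} (fst p) * h p)"
    proof (rule integrable_pair_bounded[OF h])
      show "(\<lambda>p :: real \<times> real. indicator {a..X} (fst p) :: real) \<in> borel_measurable borel"
        by (rule measurable_compose[OF fst_snd(1)]) simp
      show "\<bar>indicator {a..X} (fst p) :: real\<bar> \<le> 1" for p :: "real \<times> real" by (auto simp: indicator_def)
    qed
    then have "integrable (lborel \<Otimes>\<^sub>M lborel) (\<lambda>(x, y). indicator {a..X} x * h (x, y))"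
      by (simp add: case_prod_unfold)
    from lborel_pair.integrable_snd[OF this] show ?thesis
      unfolding H_def[abs_def] set_lebesgue_integral_def by simp
  qed
  have k: "integrable lborel k"
    using lborel_pair.integrable_fst[OF int'] unfolding k_def[abs_def] set_lebesgue_integral_def by (simp add: mult.assoc)
  have K: "(LINT x:{a..X}|lborel. k x) = r2 * G X d - m2 * (LINT y:{c..d}|lborel. G X y)" for X
  proof -
    have "(LINT x:{a..X}|lborel. k x) = (LINT x|lborel. LINT y|lborel. (indicator {a..X} x * ?q y) * h (x, y))"
      by (simp add: k_def set_lebesgue_integral_def mult.assoc)
    also have "\<dots> = (LINT y|lborel. LINT x|lborel. (indicator {a..X} x * ?q y) * h (x, y))"
      by (rule lborel_pair.Fubini_integral[OF int, symmetric])
    also have "\<dots> = (LINT y|lborel. ?q y * H X y)"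
      by (simp add: H_def set_lebesgue_integral_def mult_ac flip: integral_mult_right_zero)
    also have "\<dots> = (LINT y:{c..d}|lborel. (r2 - m2 * (d - y)) * H X y)"
      by (simp add: set_lebesgue_integral_def mult.assoc)
    also have "\<dots> = r2 * G X d - m2 * (LINT y:{c..d}|lborel. G X y)"
      using integral_by_parts_linear[OF intH ab(2)] unfolding G_def H_def by simp
    finally show ?thesis .
  qed
  have "(LINT x:{a..b}|lborel. LINT y:{c..d}|lborel. (r1 - m1 * (b - x)) * ((r2 - m2 * (d - y)) * h (x, y)))
    = (LINT x:{a..b}|lborel. (r1 - m1 * (b - x)) * k x)"
    by (simp add: k_def)
  also have "\<dots> = r1 * (LINT x:{a..b}|lborel. k x) - m1 * (LINT s:{a..b}|lborel. LINT x:{a..s}|lborel. k x)"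
    by (rule integral_by_parts_linear[OF k ab(1)])
  finally show ?thesis unfolding K .
qed

section \<open>The mixed partial derivative as a density\<close>

text \<open>The derivative is computed along rationals tending to \<open>x\<close> strictly from the
  right. As \<open>x\<close> may be irrational, \<open>e x = 0\<close> comes from
  continuity.\<close>

lemma has_real_derivative_zero_on_Rats:
  fixes e :: "real \<Rightarrow> real"
  assumes e: "(e has_real_derivative m) (at x)" and r: "0 < r"
    and zero: "\<And>q. q \<in> \<rat> \<Longrightarrow> \<bar>q - x\<bar> < r \<Longrightarrow> e q = 0"
  shows "m = 0"
proof -
  have "\<exists>q\<in>\<rat>. x < q \<and> q < x + r / real (Suc n)" for n
    using r by (intro Rats_dense_in_real) simp
  then obtain q where q: "q n \<in> \<rat>" "x < q n" "q n < x + r / real (Suc n)" for n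
    by metis
  have "(\<lambda>n. x + r * inverse (real (Suc n))) \<longlonglongrightarrow> x + r * 0"
    by (intro tendsto_intros LIMSEQ_inverse_real_of_nat)
  then have "(\<lambda>n. x + r / real (Suc n)) \<longlonglongrightarrow> x" by (simp add: divide_inverse)
  then have lim: "q \<longlonglongrightarrow> x"
    by (rule tendsto_sandwich[OF _ _ tendsto_const, rotated 2]) (auto intro!: always_eventually less_imp_le q simp del: of_nat_Suc)
  have at: "filterlim q (at x) sequentially"
    unfolding filterlim_at using lim q(2) by (auto intro!: always_eventually simp: less_imp_neq[symmetric])
  have eq: "e (q n) = 0" for n
  proof (rule zero[OF q(1)])
    have "r / real (Suc n) \<le> r" using r by (simp add: divide_le_eq)
    then show "\<bar>q n - x\<bar> < r" using q(2)[of n] q(3)[of n] by linarith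
  qed
  have "(\<lambda>n. e (q n)) \<longlonglongrightarrow> e x"
    using DERIV_isCont[OF e] lim by (rule isCont_tendsto_compose)
  then have "e x = 0" by (simp add: eq LIMSEQ_const_iff)
  have "((\<lambda>z. (e z - e x) / (z - x)) \<longlongrightarrow> m) (at x)" using e by (simp add: has_field_derivative_iff)
  then have "(\<lambda>n. (e (q n) - e x) / (q n - x)) \<longlonglongrightarrow> m" using at by (rule filterlim_compose)
  then show ?thesis by (simp add: eq \<open>e x = 0\<close> LIMSEQ_const_iff)
qed

text \<open>
  The derivatives of \<open>f (q, \<cdot>)\<close> exist for rational \<open>q\<close> near \<open>x\<close>, but \<open>f (a, \<cdot>)\<close> need not be
  differentiable at \<open>y\<close>; hence the comparison through a base point \<open>q0\<close> near \<open>x\<close>.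
\<close>

lemma mixed_partial_eq:
  assumes x: "x \<in> {a<..<b}" and y: "y \<in> {c<..<d}"
    and H: "\<And>q. q \<in> \<rat> \<inter> {a..b} \<Longrightarrow> ((\<lambda>u. f (q, u) - f (a, u)) has_real_derivative H q) (at y within {c..d})"
    and k: "(H has_real_derivative k) (at x)"
    and ex: "mixed_partial_exists {a..b} {c..d} f (x, y)"
  shows "mixed_partial {a..b} {c..d} f (x, y) = k"
proof -
  define g where "g s = partial2 {c..d} f (s, y)" for s
  have g_eq: "g s = D" if "((\<lambda>u. f (s, u)) has_real_derivative D) (at y within {c..d})" for s D
    unfolding g_def partial2_def
    using that y by (simp add: vector_derivative_within_closed_interval has_real_derivative_iff_has_vector_derivative)
  obtain r1 where r1: "0 < r1" "\<And>s. \<lbrakk>\<bar>s - x\<bar> < r1; s \<in> {a..b}\<rbrakk> \<Longrightarrow> (\<lambda>u. f (s, u)) differentiable (at y within {c..d})"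
    using ex unfolding mixed_partial_exists_def eventually_nhds_metric dist_real_def by auto
  define r where "r = min r1 (min (x - a) (b - x))"
  have r: "0 < r" using r1(1) x by (simp add: r_def)
  have in_ab: "s \<in> {a..b}" if "\<bar>s - x\<bar> < r" for s using that unfolding r_def by auto
  obtain q0 where q0: "q0 \<in> \<rat>" "x < q0" "q0 < x + r"
    using Rats_dense_in_real[of x "x + r"] r by auto
  have "(\<lambda>u. f (q0, u)) differentiable (at y within {c..d})"
    using q0 in_ab[of q0] by (intro r1(2)) (auto simp: r_def)
  then obtain D0 where D0: "((\<lambda>u. f (q0, u)) has_real_derivative D0) (at y within {c..d})"
    by (auto simp: real_differentiable_def)
  \<comment> \<open>The term \<open>f (a, u)\<close> cancels, so on the rationals near
    \<open>x\<close> the inner derivative \<open>g\<close> differs from \<open>H\<close> by the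
    constant \<open>D0 - H q0\<close>.\<close>
  have gq: "g q = H q + (D0 - H q0)" if "q \<in> \<rat>" "\<bar>q - x\<bar> < r" for q
  proof (rule g_eq)
    have "((\<lambda>u. (f (q, u) - f (a, u)) - (f (q0, u) - f (a, u)) + f (q0, u)) has_real_derivative H q - H q0 + D0)
      (at y within {c..d})"
      using that q0 in_ab by (intro DERIV_add DERIV_diff H D0) auto
    then show "((\<lambda>u. f (q, u)) has_real_derivative H q + (D0 - H q0)) (at y within {c..d})"
      by (simp add: algebra_simps)
  qed
  define m where "m = mixed_partial {a..b} {c..d} f (x, y)"
  have "g differentiable (at x within {a..b})"
    using ex unfolding mixed_partial_exists_def g_def by simp
  then have "(g has_vector_derivative m) (at x within {a..b})"
    by (simp add: vector_derivative_works m_def mixed_partial_def g_def[abs_def])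
  then have "(g has_real_derivative m) (at x)"
    using x by (simp add: has_real_derivative_iff_has_vector_derivative at_within_Icc_at)
  then have "((\<lambda>s. g s - H s - (D0 - H q0)) has_real_derivative m - k - 0) (at x)"
    by (intro DERIV_diff k DERIV_const)
  from has_real_derivative_zero_on_Rats[OF this r] show ?thesis
    using gq by (simp add: m_def)
qed

text \<open>End points are null, so closed intervals may replace half-open ones in the iterated
  integral. With \<open>s\<close> innermost, the left side is, as a function of \<open>y\<close>, an
  antiderivative of the section integrals, as needed to differentiate in the second variable
  first.\<close>

lemma rect_density:
  assumes ab: "a < b" "c < d" and ac: "rect_abs_cont a b c d f"
  obtains h :: "real \<times> real \<Rightarrow> real" where "integrable lborel h"
    "\<And>x y. \<lbrakk>x \<in> {a..b}; y \<in> {c..d}\<rbrakk> \<Longrightarrow>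
      (LINT t:{c..y}|lborel. LINT s:{a..x}|lborel. h (s, t)) = f (x, y) - f (x, c) - f (a, y) + f (a, c)"
proof -
  obtain h where h: "integrable lborel h"
    "\<And>x y. \<lbrakk>x \<in> {a..b}; y \<in> {c..d}\<rbrakk> \<Longrightarrow>
      (LINT p:{a..<x} \<times> {c..<y}|lborel. h p) = f (x, y) - f (x, c) - f (a, y) + f (a, c)"
    using rect_density_half_open[OF assms] by blast
  have "(LINT t:{c..y}|lborel. LINT s:{a..x}|lborel. h (s, t)) = (LINT p:{a..<x} \<times> {c..<y}|lborel. h p)" for x y
  proof -
    have closed: "(LINT s:{u..v}|lborel. w s) = (LINT s:{u..<v}|lborel. w s)" for u v and w :: "real \<Rightarrow> real"
      by (rule set_integral_discrete_difference[where X = "{v}"]) auto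
    have "integrable (lborel \<Otimes>\<^sub>M lborel) (\<lambda>p. indicator ({a..<x} \<times> {c..<y}) p * h p)"
      by (rule integrable_pair_bounded[OF h(1), of _ 1]) (auto intro!: borel_measurable_indicator simp: borel_Times split: split_indicator)
    then have int: "integrable (lborel \<Otimes>\<^sub>M lborel) (\<lambda>(s, t). indicator {a..<x} s * indicator {c..<y} t * h (s, t))"
      by (simp add: case_prod_unfold indicator_times)
    have "(LINT t:{c..y}|lborel. LINT s:{a..x}|lborel. h (s, t))
      = (LINT t|lborel. LINT s|lborel. indicator {a..<x} s * indicator {c..<y} t * h (s, t))"
      unfolding closed unfolding set_lebesgue_integral_def
      by (simp add: mult_ac flip: integral_mult_right_zero)
    also have "\<dots> = (LINT p|(lborel \<Otimes>\<^sub>M lborel). indicator {a..<x} (fst p) * indicator {c..<y} (snd p) * h p)"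
      using lborel_pair.integral_snd[OF int] by (simp add: case_prod_unfold)
    also have "\<dots> = (LINT p:{a..<x} \<times> {c..<y}|lborel. h p)"
      unfolding lborel_prod set_lebesgue_integral_def by (simp add: indicator_times)
    finally show ?thesis .
  qed
  with h show ?thesis using that by simp
qed

lemma mixed_partial_AE_eq_density:
  fixes h :: "real \<times> real \<Rightarrow> real"
  assumes ab: "a < b" "c < d" and h: "integrable lborel h"
    and rep: "\<And>x y. \<lbrakk>x \<in> {a..b}; y \<in> {c..d}\<rbrakk> \<Longrightarrow>
      (LINT t:{c..y}|lborel. LINT s:{a..x}|lborel. h (s, t)) = f (x, y) - f (x, c) - f (a, y) + f (a, c)"
    and ex: "AE p in lebesgue_on ({a..b} \<times> {c..d}). mixed_partial_exists {a..b} {c..d} f p"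
    and meas: "set_borel_measurable lebesgue ({a..b} \<times> {c..d}) (mixed_partial {a..b} {c..d} f)"
  shows "AE p in lborel. p \<in> {a<..<b} \<times> {c<..<d} \<longrightarrow> mixed_partial {a..b} {c..d} f p = h p"
proof -
  define H where "H x t = (LINT s:{a..x}|lborel. h (s, t))" for x t
  have h_pair: "integrable (lborel \<Otimes>\<^sub>M lborel) (\<lambda>(x, y). h (x, y))"
    using h by (simp add: lborel_prod)
  have intH: "integrable lborel (H X)" for X
  proof -
    have "integrable (lborel \<Otimes>\<^sub>M lborel) (\<lambda>p. indicator ({a..X} \<times> UNIV) p * h p)"
      by (rule integrable_pair_bounded[OF h, of _ 1]) (auto intro!: borel_measurable_indicator simp: borel_Times split: split_indicator)
    then have "integrable (lborel \<Otimes>\<^sub>M lborel) (\<lambda>(x, y). indicator {a..X} x * h (x, y))"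
      by (simp add: case_prod_unfold indicator_times)
    from lborel_pair.integrable_snd[OF this] show ?thesis
      unfolding H_def[abs_def] set_lebesgue_integral_def by simp
  qed
  \<comment> \<open>Countability of the rationals gives one null set of \<open>y\<close> for all
    \<open>q\<close>. The bound \<open>c\<close> runs over all lower limits, among them that of the
    rectangle.\<close>
  have "AE y in lborel. \<forall>q\<in>\<rat> \<inter> {a..b}. \<forall>c<y. ((\<lambda>u. LINT t:{c..u}|lborel. H q t) has_real_derivative H q y) (at y)"
    by (intro AE_ball_countable[THEN iffD2] ballI AE_has_real_derivative_integral intH)
      (auto intro: countable_rat countable_Int1)
  moreover have "AE y in lborel. integrable lborel (\<lambda>x. h (x, y))"
    by (rule lborel_pair.AE_integrable_snd[OF h_pair])
  moreover have "AE p in lborel. p \<in> {a..b} \<times> {c..d} \<longrightarrow> mixed_partial_exists {a..b} {c..d} f p"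
    using ex by (subst (asm) AE_restrict_space_iff) (auto simp: AE_completion_iff borel_Times)
  from AE_lborel_pair_swap[OF this]
  have "AE y in lborel. AE x in lborel. (x, y) \<in> {a..b} \<times> {c..d} \<longrightarrow> mixed_partial_exists {a..b} {c..d} f (x, y)" .
  ultimately have sections: "AE y in lborel. AE x in lborel.
    (x, y) \<in> {a<..<b} \<times> {c<..<d} \<longrightarrow> mixed_partial {a..b} {c..d} f (x, y) = h (x, y)"
  proof eventually_elim
    case (elim y)
    note elim_y = this
    show ?case
      using elim(3) AE_has_real_derivative_integral[OF elim(2)]
    proof eventually_elim
      case (elim x)
      note elim_x = this
      show ?case
      proof
        assume xy: "(x, y) \<in> {a<..<b} \<times> {c<..<d}"
        show "mixed_partial {a..b} {c..d} f (x, y) = h (x, y)"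
        proof (rule mixed_partial_eq[where H = "\<lambda>s. H s y"])
          show "((\<lambda>s. H s y) has_real_derivative h (x, y)) (at x)"
            unfolding H_def using elim_x(2) xy by auto
          fix q assume q: "q \<in> \<rat> \<inter> {a..b}"
          have "((\<lambda>u. LINT t:{c..u}|lborel. H q t) has_real_derivative H q y) (at y within {c..d})"
            using elim_y(1) q xy by (auto intro: has_field_derivative_at_within)
          then have "((\<lambda>u. (LINT t:{c..u}|lborel. H q t) + (f (q, c) - f (a, c))) has_real_derivative H q y + 0) (at y within {c..d})"
            by (intro DERIV_add DERIV_const)
          then have "((\<lambda>u. f (q, u) - f (a, u)) has_real_derivative H q y + 0) (at y within {c..d})"
          proof (rule has_field_derivative_transform_within[OF _ zero_less_one])
            show "y \<in> {c..d}" using xy by auto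
            fix u assume "u \<in> {c..d}"
            then show "(LINT t:{c..u}|lborel. H q t) + (f (q, c) - f (a, c)) = f (q, u) - f (a, u)"
              using rep[of q u] q by (simp add: H_def)
          qed
          then show "((\<lambda>u. f (q, u) - f (a, u)) has_real_derivative H q y) (at y within {c..d})" by simp
        qed (use elim_x xy in auto)
      qed
    qed
  qed
  \<comment> \<open>Agreement of the mixed derivative with \<open>h\<close> need not be a Borel
    condition; for its Borel version \<open>g\<close> it is, and \<open>AE_lborel_pairI\<close>
    applies.\<close>
  obtain g where g: "g \<in> borel_measurable lborel"
    "AE p in lborel. indicator ({a..b} \<times> {c..d}) p * mixed_partial {a..b} {c..d} f p = g p"
    using completion_ex_borel_measurable_real[of _ lborel] meas unfolding set_borel_measurable_def by auto
  have "AE p in lborel. p \<in> {a<..<b} \<times> {c<..<d} \<longrightarrow> g p = h p"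
  proof (rule AE_lborel_pairI)
    have [measurable]: "g \<in> borel_measurable borel" "h \<in> borel_measurable borel"
      "{a<..<b} \<times> {c<..<d} \<in> sets borel"
      using g(1) borel_measurable_integrable[OF h] by (auto simp: borel_Times)
    show "Measurable.pred borel (\<lambda>p. p \<in> {a<..<b} \<times> {c<..<d} \<longrightarrow> g p = h p)"
      by measurable
    show "AE y in lborel. AE x in lborel. (x, y) \<in> {a<..<b} \<times> {c<..<d} \<longrightarrow> g (x, y) = h (x, y)"
      using sections AE_lborel_pair_swap[OF g(2)]
    proof eventually_elim
      case (elim y)
      then show ?case
      proof eventually_elim
        case (elim x)
        then show ?case by (auto simp: indicator_def)
      qed
    qed
  qed
  with g(2) show ?thesis
  proof eventually_elim
    case (elim p)
    then show ?case by (auto simp: indicator_def)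
  qed
qed

section \<open>The identity\<close>

lemma affine_in_open_interval:
  fixes a b t :: real
  assumes "0 < t" "t < 1" "a < b"
  shows "a + (b - a) * t \<in> {a<..<b}"
proof -
  have "0 < (b - a) * t" "(b - a) * t < (b - a) * 1"
    using assms by (simp, intro mult_strict_left_mono) auto
  then show ?thesis by simp
qed

lemma integral_affine_unit_interval:
  fixes g :: "real \<Rightarrow> real"
  assumes "a < b"
  shows "(LINT t:{0..1}|lborel. g (a + (b - a) * t)) = (LINT x:{a..b}|lborel. g x) / (b - a)"
proof -
  have "(LINT x:{a..b}|lborel. g x) = (b - a) * (LINT t|lborel. indicator {a..b} (a + (b - a) * t) * g (a + (b - a) * t))"
    unfolding set_lebesgue_integral_def
    by (subst lborel_integral_real_affine[where c = "b - a" and t = a]) (use assms in auto)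
  also have "(\<lambda>t. indicator {a..b} (a + (b - a) * t) * g (a + (b - a) * t))
      = (\<lambda>t. indicator {0..1} t * g (a + (b - a) * t))"
  proof
    fix t :: real
    have "(b - a) * t \<le> b - a \<longleftrightarrow> t \<le> 1" "0 \<le> (b - a) * t \<longleftrightarrow> 0 \<le> t"
      using assms by (auto simp: mult_le_cancel_left1 zero_le_mult_iff)
    then show "indicator {a..b} (a + (b - a) * t) * g (a + (b - a) * t) = indicator {0..1} t * g (a + (b - a) * t)"
      by (auto simp: indicator_def)
  qed
  finally show ?thesis using assms by (simp add: set_lebesgue_integral_def)
qed

lemma set_integral_continuous_eq_integral:
  fixes g :: "real \<Rightarrow> real"
  assumes "continuous_on {u..v} g"
  shows "(LINT x:{u..v}|lborel. g x) = integral {u..v} g"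
    and "(LINT x:{u..v}|lebesgue. g x) = integral {u..v} g"
proof -
  have si: "set_integrable lborel {u..v} g" using assms by (rule borel_integrable_atLeastAtMost')
  then show 1: "(LINT x:{u..v}|lborel. g x) = integral {u..v} g"
    by (rule set_borel_integral_eq_integral)
  have "(LINT x:{u..v}|lebesgue. g x) = (LINT x:{u..v}|lborel. g x)"
    using si unfolding set_lebesgue_integral_def set_integrable_def by (intro integral_completion) auto
  then show "(LINT x:{u..v}|lebesgue. g x) = integral {u..v} g" unfolding 1 .
qed

text \<open>\<open>g\<close> is replaced by \<open>h\<close> in the inner integral for almost every
  \<open>t\<close>, and only then in the outer one; each replacement absorbs its null set by
  \<open>integral_lebesgue_eq_lborel\<close>.\<close>

lemma mixed_partial_integral_eq_density:
  fixes h :: "real \<times> real \<Rightarrow> real"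
  assumes ab: "a < b" "c < d" and h: "integrable lborel h"
    and eq: "AE p in lborel. p \<in> {a<..<b} \<times> {c<..<d} \<longrightarrow> g p = h p"
    and P: "P \<in> borel_measurable borel" and Q: "Q \<in> borel_measurable borel"
  shows "(LINT t:{0..1}|lebesgue. LINT l:{0..1}|lebesgue.
      P (a + (b - a) * t) * Q (c + (d - c) * l) * g (a + (b - a) * t, c + (d - c) * l))
    = (LINT x:{a..b}|lborel. LINT y:{c..d}|lborel. P x * (Q y * h (x, y))) / ((b - a) * (d - c))"
proof -
  note [measurable] = P Q
  have "h \<in> borel_measurable (borel \<Otimes>\<^sub>M borel)"
    using borel_measurable_integrable[OF h] by (simp add: borel_prod)
  note [measurable] = this
  define W where "W x = (LINT y:{c..d}|lborel. P x * (Q y * h (x, y)))" for x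
  have [measurable]: "W \<in> borel_measurable borel"
    unfolding W_def[abs_def] set_lebesgue_integral_def by measurable
  \<comment> \<open>The end points 0 and 1 are discarded, since agreement is known only in the open
    rectangle.\<close>
  have nn: "AE t in lborel. t \<noteq> (z :: real)" for z by (rule AE_lborel_singleton)
  have "AE x in lborel. AE y in lborel. (x, y) \<in> {a<..<b} \<times> {c<..<d} \<longrightarrow> g (x, y) = h (x, y)"
    using eq by (rule AE_lborel_pairD)
  then have "AE t in lborel. AE y in lborel. (a + (b - a) * t, y) \<in> {a<..<b} \<times> {c<..<d} \<longrightarrow>
      g (a + (b - a) * t, y) = h (a + (b - a) * t, y)"
    using ab by (intro AE_lborel_affine) auto
  with nn[of 0] nn[of 1]
  have "AE t in lborel. indicator {0..1} t *\<^sub>R (LINT l:{0..1}|lebesgue.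
      P (a + (b - a) * t) * Q (c + (d - c) * l) * g (a + (b - a) * t, c + (d - c) * l))
      = indicator {0..1} t *\<^sub>R (W (a + (b - a) * t) / (d - c))"
  proof eventually_elim
    case (elim t)
    show ?case
    proof (cases "t \<in> {0..1}")
      case True
      let ?x = "a + (b - a) * t"
      have t: "0 < t" "t < 1" using True elim(1,2) by auto
      have x: "?x \<in> {a<..<b}"
        using t ab by (intro affine_in_open_interval)
      have "AE l in lborel. (?x, c + (d - c) * l) \<in> {a<..<b} \<times> {c<..<d} \<longrightarrow>
        g (?x, c + (d - c) * l) = h (?x, c + (d - c) * l)"
        using ab by (intro AE_lborel_affine[OF _ elim(3)]) auto
      with nn[of 0] nn[of 1] have *: "AE l in lborel.
        indicator {0..1} l *\<^sub>R (P ?x * Q (c + (d - c) * l) * g (?x, c + (d - c) * l))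
        = indicator {0..1} l *\<^sub>R (P ?x * (Q (c + (d - c) * l) * h (?x, c + (d - c) * l)))"
      proof eventually_elim
        case (elim l)
        show ?case
        proof (cases "l \<in> {0..1}")
          case True
          then have "0 < l" "l < 1" using elim(1,2) by auto
          then have "c + (d - c) * l \<in> {c<..<d}"
            using ab by (intro affine_in_open_interval)
          then show ?thesis using elim(3) x by simp
        qed simp
      qed
      have "(LINT l:{0..1}|lebesgue. P ?x * Q (c + (d - c) * l) * g (?x, c + (d - c) * l))
        = (LINT l:{0..1}|lborel. P ?x * (Q (c + (d - c) * l) * h (?x, c + (d - c) * l)))"
        unfolding set_lebesgue_integral_def by (rule integral_lebesgue_eq_lborel[OF _ *]) measurable
      also have "\<dots> = W ?x / (d - c)"
        unfolding W_def by (rule integral_affine_unit_interval[OF ab(2)])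
      finally show ?thesis by simp
    qed simp
  qed
  then have "(LINT t:{0..1}|lebesgue. LINT l:{0..1}|lebesgue.
      P (a + (b - a) * t) * Q (c + (d - c) * l) * g (a + (b - a) * t, c + (d - c) * l))
    = (LINT t:{0..1}|lborel. W (a + (b - a) * t) / (d - c))"
    unfolding set_lebesgue_integral_def by (intro integral_lebesgue_eq_lborel) measurable
  also have "\<dots> = (LINT x:{a..b}|lborel. W x) / (b - a) / (d - c)"
    using integral_affine_unit_interval[OF ab(1), of W] by simp
  finally show ?thesis by (simp add: W_def)
qed

text \<open>\<open>R1\<close>, \<open>R2\<close> stand for \<open>r1 + 1\<close>,
  \<open>r2 + 1\<close> and \<open>L\<close>, \<open>M\<close> for the side lengths. The integrals
  over the sides at \<open>a\<close>, \<open>b\<close> are \<open>A0\<close>, \<open>A1\<close>,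
  those at \<open>c\<close>, \<open>d\<close> are \<open>C0\<close>, \<open>C1\<close>, and
  \<open>I\<close> is the double integral. The quotients \<open>R1 / L\<close> and
  \<open>R2 / M\<close> are the slopes of the weights.\<close>

lemma hermite_hadamard_algebra:
  fixes R1 R2 L M :: real
  assumes "R1 \<noteq> 0" "R2 \<noteq> 0" "L \<noteq> 0" "M \<noteq> 0"
  shows "(fac + (R2 - 1) * fad + (R1 - 1) * fbc + (R1 - 1) * (R2 - 1) * fbd) / (R1 * R2)
      + 1 / (L * M) * I - ((R1 - 1) / R1) * (1 / M) * A1 - (1 / R1) * (1 / M) * A0
      - ((R2 - 1) / R2) * (1 / L) * C1 - (1 / R2) * (1 / L) * C0
    = L * M / (R1 * R2) * (((R1 - 1) * ((R2 - 1) * (fbd - fbc - fad + fac)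
          - R2 / M * (A1 - M * fbc - A0 + M * fac))
        - R1 / L * ((R2 - 1) * (C1 - C0 - L * fad + L * fac)
          - R2 / M * (I - M * C0 - L * A0 + L * (M * fac)))) / (L * M))"
  using assms by (simp add: divide_simps) algebra

theorem lemma2:
  fixes a b c d r1 r2 :: real and f :: "real \<times> real \<Rightarrow> real"
  assumes "a < b" and "c < d"
    and "abs_continuous_on_rect a b c d f"
    and "AE p in lebesgue_on ({a..b} \<times> {c..d}). mixed_partial_exists {a..b} {c..d} f p"
    and "set_integrable lebesgue ({a..b} \<times> {c..d}) (mixed_partial {a..b} {c..d} f)"
    and "r1 \<in> {0..1}" and "r2 \<in> {0..1}"
  shows
    "(f (a, c) + r2 * f (a, d) + r1 * f (b, c) + r1 * r2 * f (b, d)) / ((r1 + 1) * (r2 + 1))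
      + 1 / ((b - a) * (d - c)) * (LINT x:{a..b}|lebesgue. (LINT y:{c..d}|lebesgue. f (x, y)))
      - (r1 / (r1 + 1)) * (1 / (d - c)) * (LINT y:{c..d}|lebesgue. f (b, y))
      - (1 / (r1 + 1)) * (1 / (d - c)) * (LINT y:{c..d}|lebesgue. f (a, y))
      - (r2 / (r2 + 1)) * (1 / (b - a)) * (LINT x:{a..b}|lebesgue. f (x, d))
      - (1 / (r2 + 1)) * (1 / (b - a)) * (LINT x:{a..b}|lebesgue. f (x, c))
     = (b - a) * (d - c) / ((r1 + 1) * (r2 + 1)) *
       (LINT t:{0..1}|lebesgue. (LINT l:{0..1}|lebesgue.
          ((r1 + 1) * t - 1) * ((r2 + 1) * l - 1) *
          mixed_partial {a..b} {c..d} f (t * b + (1 - t) * a, l * d + (1 - l) * c)))"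
proof -
  note ab = assms(1,2)
  have ac: "rect_abs_cont a b c d f" and ac1: "abs_continuous_on {a..b} (\<lambda>x. f (x, c))"
    and ac2: "abs_continuous_on {c..d} (\<lambda>y. f (a, y))"
    using assms(3) unfolding abs_continuous_on_rect_def rect_abs_cont_def by auto
  define F where "F x y = f (x, y) - f (x, c) - f (a, y) + f (a, c)" for x y
  \<comment> \<open>\<open>f\<close> is recovered from its increment by adding back its values along
    the two sides, which are continuous there.\<close>
  have cont: "continuous_on ({a..b} \<times> {c..d}) (\<lambda>(x, y). f (x, y))"
  proof -
    have "continuous_on ({a..b} \<times> {c..d}) (\<lambda>p. (case p of (x, y) \<Rightarrow> F x y) + f (fst p, c) + f (a, snd p) - f (a, c))"
      unfolding F_def
      by (intro continuous_intros continuous_on_increment ac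
          continuous_on_compose2[OF abs_continuous_on_imp_continuous_on[OF ac1]]
          continuous_on_compose2[OF abs_continuous_on_imp_continuous_on[OF ac2]]) auto
    then show ?thesis by (simp add: case_prod_unfold F_def)
  qed
  have cont_x: "continuous_on {a..b} (\<lambda>x. f (x, y))" if "y \<in> {c..d}" for y
    using continuous_on_compose2[OF cont, of "{a..b}" "\<lambda>x. (x, y)"] that
    by (simp add: continuous_on_Pair image_subset_iff)
  have cont_y: "continuous_on {c..d} (\<lambda>y. f (x, y))" if "x \<in> {a..b}" for x
    using continuous_on_compose2[OF cont, of "{c..d}" "\<lambda>y. (x, y)"] that
    by (simp add: continuous_on_Pair image_subset_iff)
  have ends: "a \<in> {a..b}" "b \<in> {a..b}" "c \<in> {c..d}" "d \<in> {c..d}" using ab by auto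
  define J where "J x = integral {c..d} (\<lambda>y. f (x, y))" for x
  have cont_J: "continuous_on {a..b} J"
    using integral_continuous_on_param[of "{a..b}" c d "\<lambda>x y. f (x, y)"] cont
    by (simp add: J_def[abs_def] cbox_interval)
  define A0 A1 C0 C1 D where "A0 = integral {c..d} (\<lambda>y. f (a, y))" and "A1 = integral {c..d} (\<lambda>y. f (b, y))"
    and "C0 = integral {a..b} (\<lambda>x. f (x, c))" and "C1 = integral {a..b} (\<lambda>x. f (x, d))" and "D = integral {a..b} J"
  obtain h where h: "integrable lborel h" and rep: "\<And>x y. \<lbrakk>x \<in> {a..b}; y \<in> {c..d}\<rbrakk> \<Longrightarrow>
      (LINT t:{c..y}|lborel. LINT s:{a..x}|lborel. h (s, t)) = f (x, y) - f (x, c) - f (a, y) + f (a, c)"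
    using rect_density[OF ab ac] by blast
  \<comment> \<open>With these slopes the weights run from -1 at \<open>a\<close> and
    \<open>c\<close> to \<open>r1\<close> at \<open>b\<close> and \<open>r2\<close> at
    \<open>d\<close>; pulled back to the unit interval they are \<open>(r1 + 1) * t - 1\<close> and
    \<open>(r2 + 1) * l - 1\<close>.\<close>
  define m1 m2 where "m1 = (r1 + 1) / (b - a)" and "m2 = (r2 + 1) / (d - c)"
  have const: "((\<lambda>_. z) has_integral (b - a) * z) {a..b}" "((\<lambda>_. z) has_integral (d - c) * z) {c..d}" for z :: real
    using has_integral_const_real[of z a b] has_integral_const_real[of z c d] ab by simp_all
  have int_F: "(LINT y:{c..d}|lborel. LINT t:{c..y}|lborel. LINT s:{a..x}|lborel. h (s, t))
    = J x - (d - c) * f (x, c) - A0 + (d - c) * f (a, c)" if x: "x \<in> {a..b}" for x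
  proof -
    have "(LINT y:{c..d}|lborel. LINT t:{c..y}|lborel. LINT s:{a..x}|lborel. h (s, t)) = (LINT y:{c..d}|lborel. F x y)"
      by (rule set_lebesgue_integral_cong) (auto simp: rep[OF x] F_def)
    also have "\<dots> = integral {c..d} (F x)"
      unfolding F_def using x ends by (intro set_integral_continuous_eq_integral continuous_intros cont_y)
    also have "(F x has_integral J x - (d - c) * f (x, c) - A0 + (d - c) * f (a, c)) {c..d}"
      unfolding F_def[abs_def] J_def A0_def using x ends ab
      by (intro has_integral_add has_integral_diff const(2) integrable_integral integrable_continuous_interval cont_y)
    then have "integral {c..d} (F x) = J x - (d - c) * f (x, c) - A0 + (d - c) * f (a, c)"
      by (simp add: integral_unique)
    finally show ?thesis .
  qed
  \<comment> \<open>The \<open>x\<close>-integral that remains in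
    \<open>integral_by_parts_bilinear\<close>, evaluated through \<open>rep\<close> and
    \<open>int_F\<close>.\<close>
  have int_G: "(LINT x:{a..b}|lborel. r2 * (LINT t:{c..d}|lborel. LINT s:{a..x}|lborel. h (s, t))
      - m2 * (LINT y:{c..d}|lborel. LINT t:{c..y}|lborel. LINT s:{a..x}|lborel. h (s, t)))
    = r2 * (C1 - C0 - (b - a) * f (a, d) + (b - a) * f (a, c))
      - m2 * (D - (d - c) * C0 - (b - a) * A0 + (b - a) * ((d - c) * f (a, c)))" (is "?l = ?r")
  proof -
    let ?g = "\<lambda>x. r2 * (f (x, d) - f (x, c) - f (a, d) + f (a, c))
      - m2 * (J x - (d - c) * f (x, c) - A0 + (d - c) * f (a, c))"
    have "?l = (LINT x:{a..b}|lborel. ?g x)"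
      using ends by (intro set_lebesgue_integral_cong) (auto simp: rep int_F)
    also have "\<dots> = integral {a..b} ?g"
      using ends by (intro set_integral_continuous_eq_integral continuous_intros cont_x cont_J)
    also have "(?g has_integral r2 * (C1 - C0 - (b - a) * f (a, d) + (b - a) * f (a, c))
      - m2 * (D - (d - c) * C0 - (b - a) * A0 + (b - a) * ((d - c) * f (a, c)))) {a..b}"
      unfolding C0_def C1_def D_def using ends ab
      by (intro has_integral_add has_integral_diff has_integral_mult_right const(1) integrable_integral
          integrable_continuous_interval cont_x cont_J)
    then have "integral {a..b} ?g = ?r" by (simp add: integral_unique)
    finally show ?thesis .
  qed
  have "AE p in lborel. p \<in> {a<..<b} \<times> {c<..<d} \<longrightarrow> mixed_partial {a..b} {c..d} f p = h p"
  proof (rule mixed_partial_AE_eq_density[OF ab h rep assms(4)])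
    show "set_borel_measurable lebesgue ({a..b} \<times> {c..d}) (mixed_partial {a..b} {c..d} f)"
      using assms(5) unfolding set_integrable_def set_borel_measurable_def by (rule borel_measurable_integrable)
  qed
  from mixed_partial_integral_eq_density[OF ab h this, of "\<lambda>x. r1 - m1 * (b - x)" "\<lambda>y. r2 - m2 * (d - y)"]
  have "(LINT t:{0..1}|lebesgue. LINT l:{0..1}|lebesgue. (r1 - m1 * (b - (a + (b - a) * t)))
      * (r2 - m2 * (d - (c + (d - c) * l))) * mixed_partial {a..b} {c..d} f (a + (b - a) * t, c + (d - c) * l))
    = (LINT x:{a..b}|lborel. LINT y:{c..d}|lborel. (r1 - m1 * (b - x)) * ((r2 - m2 * (d - y)) * h (x, y)))
      / ((b - a) * (d - c))" by simp
  also have "(LINT x:{a..b}|lborel. LINT y:{c..d}|lborel. (r1 - m1 * (b - x)) * ((r2 - m2 * (d - y)) * h (x, y)))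
    = r1 * (r2 * (f (b, d) - f (b, c) - f (a, d) + f (a, c)) - m2 * (A1 - (d - c) * f (b, c) - A0 + (d - c) * f (a, c)))
      - m1 * (r2 * (C1 - C0 - (b - a) * f (a, d) + (b - a) * f (a, c))
        - m2 * (D - (d - c) * C0 - (b - a) * A0 + (b - a) * ((d - c) * f (a, c))))"
    unfolding integral_by_parts_bilinear[OF h less_imp_le[OF ab(1)] less_imp_le[OF ab(2)]]
      int_G int_F[OF ends(2)] rep[OF ends(2,4)] J_def A1_def by (rule refl)
  also have "(\<lambda>t l. (r1 - m1 * (b - (a + (b - a) * t))) * (r2 - m2 * (d - (c + (d - c) * l)))
      * mixed_partial {a..b} {c..d} f (a + (b - a) * t, c + (d - c) * l))
    = (\<lambda>t l. ((r1 + 1) * t - 1) * ((r2 + 1) * l - 1) *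
          mixed_partial {a..b} {c..d} f (t * b + (1 - t) * a, l * d + (1 - l) * c))"
  proof (intro ext)
    fix t l :: real
    have "m1 * (b - a) = r1 + 1" "m2 * (d - c) = r2 + 1" using ab by (simp_all add: m1_def m2_def)
    then have "r1 - m1 * (b - (a + (b - a) * t)) = (r1 + 1) * t - 1"
      "r2 - m2 * (d - (c + (d - c) * l)) = (r2 + 1) * l - 1" by algebra+
    moreover have "a + (b - a) * t = t * b + (1 - t) * a" "c + (d - c) * l = l * d + (1 - l) * c"
      by (simp_all add: algebra_simps)
    ultimately show "(r1 - m1 * (b - (a + (b - a) * t))) * (r2 - m2 * (d - (c + (d - c) * l)))
      * mixed_partial {a..b} {c..d} f (a + (b - a) * t, c + (d - c) * l)
      = ((r1 + 1) * t - 1) * ((r2 + 1) * l - 1) *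
          mixed_partial {a..b} {c..d} f (t * b + (1 - t) * a, l * d + (1 - l) * c)" by simp
  qed
  finally have rhs: "(LINT t:{0..1}|lebesgue. (LINT l:{0..1}|lebesgue.
          ((r1 + 1) * t - 1) * ((r2 + 1) * l - 1) *
          mixed_partial {a..b} {c..d} f (t * b + (1 - t) * a, l * d + (1 - l) * c)))
    = (r1 * (r2 * (f (b, d) - f (b, c) - f (a, d) + f (a, c)) - m2 * (A1 - (d - c) * f (b, c) - A0 + (d - c) * f (a, c)))
      - m1 * (r2 * (C1 - C0 - (b - a) * f (a, d) + (b - a) * f (a, c))
        - m2 * (D - (d - c) * C0 - (b - a) * A0 + (b - a) * ((d - c) * f (a, c))))) / ((b - a) * (d - c))" .
  have "(LINT x:{a..b}|lebesgue. (LINT y:{c..d}|lebesgue. f (x, y))) = (LINT x:{a..b}|lebesgue. J x)"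
    by (rule set_lebesgue_integral_cong) (auto simp: J_def set_integral_continuous_eq_integral cont_y)
  also have "\<dots> = D" unfolding D_def by (rule set_integral_continuous_eq_integral[OF cont_J])
  finally have lhs: "(LINT x:{a..b}|lebesgue. (LINT y:{c..d}|lebesgue. f (x, y))) = D"
    "(LINT y:{c..d}|lebesgue. f (b, y)) = A1" "(LINT y:{c..d}|lebesgue. f (a, y)) = A0"
    "(LINT x:{a..b}|lebesgue. f (x, d)) = C1" "(LINT x:{a..b}|lebesgue. f (x, c)) = C0"
    using ends by (simp_all add: A0_def A1_def C0_def C1_def set_integral_continuous_eq_integral cont_x cont_y)
  show ?thesis
    unfolding rhs lhs m1_def m2_def
    using hermite_hadamard_algebra[of "r1 + 1" "r2 + 1" "b - a" "d - c"] ab assms(6,7) by simp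
qed

end
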